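(* Let $k_1>0$ and $k_2=0$. Then there exists $\varepsilon=\varepsilon(k_1)>0$ such that for all $|m_1l_1-m_3l_3|<\varepsilon$ the system $$\dot\varphi_1=v_1,\qquad \dot v_1=\left(r_1-\frac{A_{12}}{A_{22}}r_2\right)\left(A_{11}-\frac{A_{12}^2}{A_{22}}\right)^{-1},\qquad \dot v_2=\left(r_2-\frac{A_{12}}{A_{11}}r_1\right)\left(A_{22}-\frac{A_{12}^2}{A_{11}}\right)^{-1}$$ with state variables $(\varphi_1,v_1,v_2)$ has a two-parameter family of periodic solutions.
   Context: This is the reduced system of the Ziegler pendulum (a planar double pendulum with point masses $m_1,m_2,m_3>0$, rod lengths $l_1,l_2,l_3>0$, a follower force of constant magnitude $F$, stiffness $k_1$ of the spring between the rods) with zero stiffness $k_2=0$ of the spring at the pivot. Here $$A_{11}=m_1l_1^2+m_3l_3^2,$$ $$A_{12}=m_1l_1^2+m_3l_3^2+(m_1l_1-m_3l_3)l_2\cos\varphi_1,$$ $$A_{22}=(m_1+m_2+m_3)l_2^2+m_1l_1^2+m_3l_3^2+2(m_1l_1-m_3l_3)l_2\cos\varphi_1,$$ $$r_1=-k_1\varphi_1-(m_1l_1-m_3l_3)l_2v_2^2\sin\varphi_1,$$ $$r_2=-Fl_2\sin\varphi_1+(m_1l_1-m_3l_3)l_2v_1(v_1+2v_2)\sin\varphi_1.$$ A two-parameter family of periodic solutions means: there are a nonempty open set $U\subset\mathbb{R}^2$ and a smooth injective immersion $\sigma:U\to\mathbb{R}^3$, transverse to the vector field of the system, such that for each $u\in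 U$ the solution through $\sigma(u)$ is non-constant and periodic, and distinct $u$ give distinct trajectories. *)

theory Defs
  imports "HOL-Analysis.Analysis"
begin

section \<open>Smooth maps\<close>

text \<open>Class $C^n$ on an open set \<open>S\<close>: the recursion runs through all iterated directional
  derivatives. It is intended for open \<open>S\<close> only, since it uses the derivative at \<open>x\<close> in the
  whole space.\<close>

primrec Cn_on :: "nat \<Rightarrow> 'a::euclidean_space set \<Rightarrow> ('a \<Rightarrow> 'b::euclidean_space) \<Rightarrow> bool" where
  "Cn_on 0 S f \<longleftrightarrow> continuous_on S f"
| "Cn_on (Suc n) S f \<longleftrightarrow>
     (\<forall>x\<in>S. f differentiable (at x)) \<and> (\<forall>v. Cn_on n S (\<lambda>x. frechet_derivative f (at x) v))"

definition smooth_on :: "'a::euclidean_space set \<Rightarrow> ('a \<Rightarrow> 'b::euclidean_space) \<Rightarrow> bool" where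
  "smooth_on S f \<longleftrightarrow> (\<forall>n. Cn_on n S f)"

section \<open>Families of periodic solutions of an autonomous system\<close>

type_synonym state = "real \<times> real \<times> real"

definition solution :: "(state \<Rightarrow> state) \<Rightarrow> (real \<Rightarrow> state) \<Rightarrow> bool" where
  "solution X x \<longleftrightarrow> (\<forall>t. (x has_vector_derivative X (x t)) (at t))"

definition periodic :: "(real \<Rightarrow> state) \<Rightarrow> bool" where
  "periodic x \<longleftrightarrow> (\<exists>T>0. \<forall>t. x (t + T) = x t)"

text \<open>A parametrised surface in the three-dimensional state space is transverse to \<open>X\<close> when
  \<open>X\<close> is nowhere tangent to it. The trajectory of a solution is its range; \<open>x u\<close> is the solution
  through \<open>\<sigma> u\<close>, which is unique for locally Lipschitz \<open>X\<close>.\<close>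

definition two_parameter_family_of_periodic_solutions :: "(state \<Rightarrow> state) \<Rightarrow> bool" where
  "two_parameter_family_of_periodic_solutions X \<longleftrightarrow>
     (\<exists>(U :: (real \<times> real) set) (\<sigma> :: real \<times> real \<Rightarrow> state) (x :: real \<times> real \<Rightarrow> real \<Rightarrow> state).
        open U \<and> U \<noteq> {} \<and>
        smooth_on U \<sigma> \<and> inj_on \<sigma> U \<and>
        (\<forall>u\<in>U. inj (frechet_derivative \<sigma> (at u))) \<and>
        (\<forall>u\<in>U. X (\<sigma> u) \<notin> range (frechet_derivative \<sigma> (at u))) \<and>
        (\<forall>u\<in>U. solution X (x u) \<and> x u 0 = \<sigma> u \<and> \<not> x u constant_on UNIV \<and> periodic (x u)) \<and>
        (\<forall>u\<in>U. \<forall>u'\<in>U. u \<noteq> u' \<longrightarrow> range (x u) \<noteq> range (x u')))"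

section \<open>The reduced Ziegler pendulum\<close>

text \<open>The stiffness of the spring at the pivot is zero; \<open>k1\<close> is the stiffness of the spring
  between the rods and \<open>F\<close> the follower force. For positive masses and lengths
  $A_{11} > 0$, $A_{22} > 0$ and $A_{11} A_{22} - A_{12}^2 > 0$, so no denominator below vanishes.\<close>

definition A11 :: "real \<Rightarrow> real \<Rightarrow> real \<Rightarrow> real \<Rightarrow> real" where
  "A11 m1 m3 l1 l3 = m1 * l1\<^sup>2 + m3 * l3\<^sup>2"

definition A12 :: "real \<Rightarrow> real \<Rightarrow> real \<Rightarrow> real \<Rightarrow> real \<Rightarrow> real \<Rightarrow> real" where
  "A12 m1 m3 l1 l2 l3 \<phi>1 = m1 * l1\<^sup>2 + m3 * l3\<^sup>2 + (m1 * l1 - m3 * l3) * l2 * cos \<phi>1"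

definition A22 :: "real \<Rightarrow> real \<Rightarrow> real \<Rightarrow> real \<Rightarrow> real \<Rightarrow> real \<Rightarrow> real \<Rightarrow> real" where
  "A22 m1 m2 m3 l1 l2 l3 \<phi>1 =
     (m1 + m2 + m3) * l2\<^sup>2 + m1 * l1\<^sup>2 + m3 * l3\<^sup>2 + 2 * (m1 * l1 - m3 * l3) * l2 * cos \<phi>1"

definition r1 :: "real \<Rightarrow> real \<Rightarrow> real \<Rightarrow> real \<Rightarrow> real \<Rightarrow> real \<Rightarrow> real \<Rightarrow> real \<Rightarrow> real" where
  "r1 m1 m3 l1 l2 l3 k1 \<phi>1 v2 = - k1 * \<phi>1 - (m1 * l1 - m3 * l3) * l2 * v2\<^sup>2 * sin \<phi>1"

definition r2 ::
  "real \<Rightarrow> real \<Rightarrow> real \<Rightarrow> real \<Rightarrow> real \<Rightarrow> real \<Rightarrow> real \<Rightarrow> real \<Rightarrow> real \<Rightarrow> real" where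
  "r2 m1 m3 l1 l2 l3 F \<phi>1 v1 v2 =
     - F * l2 * sin \<phi>1 + (m1 * l1 - m3 * l3) * l2 * v1 * (v1 + 2 * v2) * sin \<phi>1"

definition ziegler_field ::
  "real \<Rightarrow> real \<Rightarrow> real \<Rightarrow> real \<Rightarrow> real \<Rightarrow> real \<Rightarrow> real \<Rightarrow> real \<Rightarrow> state \<Rightarrow> state" where
  "ziegler_field m1 m2 m3 l1 l2 l3 F k1 = (\<lambda>(\<phi>1, v1, v2).
     let a11 = A11 m1 m3 l1 l3;
         a12 = A12 m1 m3 l1 l2 l3 \<phi>1;
         a22 = A22 m1 m2 m3 l1 l2 l3 \<phi>1;
         \<rho>1 = r1 m1 m3 l1 l2 l3 k1 \<phi>1 v2;
         \<rho>2 = r2 m1 m3 l1 l2 l3 F \<phi>1 v1 v2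
     in (v1,
         (\<rho>1 - a12 / a22 * \<rho>2) * inverse (a11 - a12\<^sup>2 / a22),
         (\<rho>2 - a12 / a11 * \<rho>1) * inverse (a22 - a12\<^sup>2 / a11)))"

end

theory Submission
  imports Defs
begin

text \<open>Write \<open>p = A12 v1 + A22 v2\<close> for the momentum conjugate to the absolute angle. The kinetic energy
  is \<open>p\<^sup>2 / (2 A22) + v1\<^sup>2 / (2 q\<^sup>2)\<close>, where \<open>q\<^sup>2 = A22 / (A11 A22 - A12\<^sup>2)\<close> is the inverse of the
  effective inertia of the relative angle \<open>\<phi>\<close>. In the coordinates \<open>(\<phi>, w, p)\<close> with \<open>v1 = q w\<close> the
  system becomes
  \<open>\<phi>' = q(\<phi>) w\<close>, \<open>w' = q(\<phi>) (h(\<phi>) - k1 \<phi> - g(\<phi>) p\<^sup>2)\<close>, \<open>p' = - f(\<phi>)\<close>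
  with \<open>q\<close> even, bounded and bounded away from 0, and \<open>h\<close>, \<open>g\<close>, \<open>f\<close> odd and bounded: a spring
  oscillator with a perturbation that stays bounded as long as \<open>p\<close> does.

  Two features give the periodic orbits. The first is reversibility: \<open>(\<phi>, w, p) \<mapsto> (- \<phi>, w, p)\<close> sends
  the field to its negative, and it fixes the whole plane \<open>\<phi> = 0\<close> pointwise. Hence an arc of a
  solution with both end points on that plane, followed by its mirror image, closes up to a
  periodic solution (\<open>reflected_arc_periodic_solution\<close>). The second is that fast orbits do return to
  the plane: \<open>p\<close> has bounded derivative, so it is bounded over a fixed time, and for a large
  initial velocity the spring dominates the perturbation, so that the point
  \<open>(sqrt k1 \<phi>, w)\<close> rotates about the origin at a rate bounded below; after a fixed time it must have
  left the half plane \<open>\<phi> > 0\<close> (\<open>return_to_section\<close>).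

  The initial conditions \<open>(0, w, p)\<close> with \<open>w\<close> large and \<open>p\<close> between -1 and 1 form the
  two-dimensional family. The surface is transverse to the field because \<open>\<phi>' > 0\<close> on it, and an
  orbit meets \<open>\<phi> = 0\<close> with \<open>\<phi>' > 0\<close> only once per period, so distinct initial points lie on
  distinct trajectories. The arcs to be reflected come from a contraction argument for globally
  Lipschitz fields, extended to fields of linear growth by truncation
  (\<open>linear_growth_integral_curve\<close>).\<close>

section \<open>Integral curves of fields of linear growth\<close>

lemma increment_le_of_derivative_le:
  fixes f :: "real \<Rightarrow> real"
  assumes "a \<le> b"
    and der: "\<And>s. s \<in> {a..b} \<Longrightarrow> (f has_real_derivative f' s) (at s within {a..b})"
    and le: "\<And>s. s \<in> {a..b} \<Longrightarrow> f' s \<le> c"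
  shows "f b - f a \<le> c * (b - a)"
proof -
  obtain s where "s \<in> {a..b}" "f b - f a = f' s * (b - a)"
    using mvt_very_simple[OF \<open>a \<le> b\<close>, of f "\<lambda>s. (*) (f' s)"] der
    by (auto simp: has_field_derivative_def)
  then show ?thesis using le \<open>a \<le> b\<close> by (simp add: mult_right_mono)
qed

text \<open>Picard iteration on the whole of \<open>[0, T]\<close> at once: measured with the weight \<open>exp (- K t)\<close>, the
  integral operator contracts by the factor \<open>L / K\<close>, which is less than 1 for \<open>K > L\<close>. So the
  unknown is \<open>y t = exp (- K t) (x t - x0)\<close>.\<close>

lemma lipschitz_field_integral_curve:
  fixes f :: "'a::euclidean_space \<Rightarrow> 'a"
  assumes lip: "L-lipschitz_on UNIV f" and T: "0 \<le> T"
  obtains x where "x 0 = x0"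
    and "\<And>t. t \<in> {0..T} \<Longrightarrow> (x has_vector_derivative f (x t)) (at t within {0..T})"
proof -
  define K where "K = L + 1"
  have L: "0 \<le> L" using lip by (rule lipschitz_on_nonneg)
  have K: "0 < K" "L / K < 1" "0 \<le> L / K" using L by (auto simp: K_def)
  have cf: "continuous_on S f" for S
    using lipschitz_on_continuous_on[OF lip] continuous_on_subset by blast
  define v where "v y s = f (x0 + exp (K * s) *\<^sub>R y s)" for y :: "real \<Rightarrow>\<^sub>C 'a" and s
  have cv: "continuous_on S (v y)" for S y
    unfolding v_def by (intro continuous_on_compose2[OF cf[of UNIV]] continuous_intros) auto
  define h where "h y t = exp (- K * t) *\<^sub>R integral {0..t} (v y)" for y t
  have ch: "continuous_on {0..T} (h y)" for y
    unfolding h_def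
    by (intro continuous_intros indefinite_integral_continuous_1 integrable_continuous_interval cv)
  \<comment> \<open>Freezing the argument outside \<open>[0, T]\<close> puts the iterates into the complete space of
    bounded continuous functions on the line.\<close>
  define c where "c t = max 0 (min T t)" for t :: real
  have c: "c t \<in> {0..T}" for t using T by (auto simp: c_def)
  have cc: "continuous_on UNIV c" unfolding c_def by (intro continuous_intros)
  have mem: "(\<lambda>t. h y (c t)) \<in> bcontfun" for y
  proof -
    have "continuous_on UNIV (\<lambda>t. h y (c t))"
      by (rule continuous_on_compose2[OF ch cc]) (use c in auto)
    moreover have "bounded (h y ` {0..T})"
      by (intro compact_imp_bounded compact_continuous_image ch) auto
    then have "bounded (range (\<lambda>t. h y (c t)))"
      by (rule bounded_subset) (use c in auto)
    ultimately show ?thesis by (simp add: bcontfun_def)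
  qed
  define P where "P y = Bcontfun (\<lambda>t. h y (c t))" for y
  have P: "apply_bcontfun (P y) t = h y (c t)" for y t
    unfolding P_def by (simp add: Bcontfun_inverse[OF mem])
  have contr: "dist (h y r) (h z r) \<le> L / K * dist y z" if r: "r \<in> {0..T}" for y z r
  proof -
    let ?d = "dist y z"
    have I: "((\<lambda>s. L * exp (K * s) * ?d) has_integral (L / K * exp (K * r) * ?d - L / K * exp (K * 0) * ?d)) {0..r}"
      using r K(1)
      by (intro fundamental_theorem_of_calculus)
         (auto intro!: derivative_eq_intros simp: has_real_derivative_iff_has_vector_derivative[symmetric])
    have "norm (integral {0..r} (\<lambda>s. v y s - v z s)) \<le> integral {0..r} (\<lambda>s. L * exp (K * s) * ?d)"
    proof (rule integral_norm_bound_integral)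
      show "(\<lambda>s. v y s - v z s) integrable_on {0..r}"
        by (intro integrable_continuous_interval continuous_intros cv)
      show "(\<lambda>s. L * exp (K * s) * ?d) integrable_on {0..r}" using I by blast
      fix s
      have "norm (v y s - v z s) \<le> L * norm (exp (K * s) *\<^sub>R (y s - z s))"
        unfolding v_def using lipschitz_on_normD[OF lip, of "x0 + exp (K * s) *\<^sub>R y s" "x0 + exp (K * s) *\<^sub>R z s"]
        by (simp add: scaleR_diff_right)
      also have "\<dots> \<le> L * (exp (K * s) * ?d)"
        using dist_bounded[of y s z] L by (intro mult_left_mono) (auto simp: dist_norm)
      finally show "norm (v y s - v z s) \<le> L * exp (K * s) * ?d" by (simp add: mult.assoc)
    qed
    also have "\<dots> \<le> exp (K * r) * (L / K * ?d)"
      using integral_unique[OF I] mult_nonneg_nonneg[OF K(3) zero_le_dist[of y z]]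
      by (simp add: mult.assoc mult.left_commute)
    finally have "norm (integral {0..r} (v y) - integral {0..r} (v z)) \<le> exp (K * r) * (L / K * ?d)"
      by (subst integral_diff[symmetric]) (auto intro!: integrable_continuous_interval cv)
    then have "exp (- K * r) * norm (integral {0..r} (v y) - integral {0..r} (v z))
        \<le> exp (- K * r) * (exp (K * r) * (L / K * ?d))"
      by (intro mult_left_mono) auto
    also have "\<dots> = L / K * ?d" by (simp add: exp_minus)
    finally show ?thesis by (simp add: h_def dist_norm flip: scaleR_diff_right)
  qed
  have "dist (P y) (P z) \<le> L / K * dist y z" for y z
    by (rule dist_bound) (simp only: P contr[OF c])
  then obtain y where y: "P y = y"
    using banach_fix_type[OF K(3,2), of P] by blast
  define x where "x t = x0 + exp (K * t) *\<^sub>R y t" for t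
  have vx: "v y = (\<lambda>s. f (x s))" by (auto simp: v_def x_def)
  have x: "x t = x0 + integral {0..t} (v y)" if "t \<in> {0..T}" for t
  proof -
    have "c t = t" using that by (auto simp: c_def)
    then have "y t = h y t" using P[of y t] y by simp
    then show ?thesis by (simp add: x_def h_def exp_minus)
  qed
  show ?thesis
  proof
    show "x 0 = x0" using x[of 0] T by simp
    fix t assume t: "t \<in> {0..T}"
    have "((\<lambda>t. x0 + integral {0..t} (v y)) has_vector_derivative 0 + v y t) (at t within {0..T})"
      by (intro has_vector_derivative_add has_vector_derivative_const integral_has_vector_derivative cv t)
    then have "((\<lambda>t. x0 + integral {0..t} (v y)) has_vector_derivative f (x t)) (at t within {0..T})"
      by (simp add: vx)
    then show "(x has_vector_derivative f (x t)) (at t within {0..T})"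
      by (rule has_vector_derivative_transform[OF t x, rotated])
  qed
qed

definition lipschitz_on_balls :: "('a::real_normed_vector \<Rightarrow> 'b::real_normed_vector) \<Rightarrow> bool" where
  "lipschitz_on_balls f \<longleftrightarrow> (\<forall>R. \<exists>L. L-lipschitz_on (cball 0 R) f)"

text \<open>Composing the field with the projection onto a large ball makes it globally Lipschitz and keeps the
  linear growth bound, with the same \<open>K\<close> for every radius. A Gronwall estimate for
  \<open>1 + norm (x t)^2\<close> therefore confines the solution up to time \<open>T\<close> to a ball whose radius can be
  fixed in advance, and there the truncated field is the original one.\<close>

lemma linear_growth_integral_curve:
  fixes f :: "'a::euclidean_space \<Rightarrow> 'a"
  assumes lip: "lipschitz_on_balls f" and growth: "\<And>z. norm (f z) \<le> K * (1 + norm z)"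
    and T: "0 \<le> T"
  obtains x where "x 0 = x0"
    and "\<And>t. t \<in> {0..T} \<Longrightarrow> (x has_vector_derivative f (x t)) (at t within {0..T})"
proof -
  have K: "0 \<le> K" using order_trans[OF norm_ge_zero growth[of 0]] by simp
  define R where "R = sqrt ((1 + (norm x0)\<^sup>2) * exp (4 * K * T))"
  define \<pi> where "\<pi> = closest_point (cball (0::'a) R)"
  have R: "0 \<le> R" by (simp add: R_def)
  have cb: "convex (cball (0::'a) R)" "closed (cball (0::'a) R)" "cball (0::'a) R \<noteq> {}"
    using R by auto
  have \<pi>_lip: "dist (\<pi> a) (\<pi> b) \<le> dist a b" for a b
    unfolding \<pi>_def by (rule closest_point_lipschitz[OF cb])
  have \<pi>_id: "\<pi> a = a" if "norm a \<le> R" for a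
    unfolding \<pi>_def by (rule closest_point_self) (use that in auto)
  have \<pi>_in: "\<pi> a \<in> cball 0 R" for a
    unfolding \<pi>_def by (rule closest_point_in_set[OF cb(2,3)])
  have \<pi>_norm: "norm (\<pi> a) \<le> norm a" for a
    using \<pi>_lip[of a 0] \<pi>_id[of 0] R by simp
  obtain L where L: "L-lipschitz_on (cball 0 R) f"
    using lip unfolding lipschitz_on_balls_def by blast
  have "L-lipschitz_on UNIV (\<lambda>z. f (\<pi> z))"
  proof (rule lipschitz_onI)
    show L0: "0 \<le> L" using L by (rule lipschitz_on_nonneg)
    fix a b
    have "dist (f (\<pi> a)) (f (\<pi> b)) \<le> L * dist (\<pi> a) (\<pi> b)"
      by (rule lipschitz_onD[OF L \<pi>_in \<pi>_in])
    also have "\<dots> \<le> L * dist a b" by (rule mult_left_mono[OF \<pi>_lip L0])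
    finally show "dist (f (\<pi> a)) (f (\<pi> b)) \<le> L * dist a b" .
  qed
  then obtain x where x0: "x 0 = x0"
    and x: "\<And>t. t \<in> {0..T} \<Longrightarrow> (x has_vector_derivative f (\<pi> (x t))) (at t within {0..T})"
    using T by (rule lipschitz_field_integral_curve[where ?x0.0=x0]) blast
  define N where "N t = (1 + x t \<bullet> x t) * exp (- 4 * K * t)" for t
  have bound: "norm (x t) \<le> R" if t: "t \<in> {0..T}" for t
  proof -
    have "N t - N 0 \<le> 0 * (t - 0)"
    proof (rule increment_le_of_derivative_le)
      fix s assume s: "s \<in> {0..t}"
      let ?u = "f (\<pi> (x s))" and ?n = "norm (x s)"
      have d: "(x has_vector_derivative ?u) (at s within {0..t})"
        by (rule has_vector_derivative_within_subset[OF x]) (use s t in auto)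
      show "(N has_real_derivative ((2 * (x s \<bullet> ?u) - 4 * K * (1 + x s \<bullet> x s)) * exp (- 4 * K * s)))
          (at s within {0..t})"
        unfolding N_def has_field_derivative_def
        by (rule derivative_eq_intros d[unfolded has_vector_derivative_def] refl)+
           (auto simp: algebra_simps inner_commute)
      have "norm ?u \<le> K * (1 + norm (\<pi> (x s)))" by (rule growth)
      also have "\<dots> \<le> K * (1 + ?n)" using \<pi>_norm[of "x s"] K by (intro mult_left_mono) auto
      finally have u: "norm ?u \<le> K * (1 + ?n)" .
      have "x s \<bullet> ?u \<le> ?n * norm ?u" by (rule norm_cauchy_schwarz)
      also have "\<dots> \<le> ?n * (K * (1 + ?n))" using u by (rule mult_left_mono) simp
      also have "\<dots> = K * (?n + ?n\<^sup>2)"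
        by (simp add: algebra_simps power2_eq_square)
      also have "\<dots> \<le> K * (2 * (1 + ?n\<^sup>2))"
      proof (rule mult_left_mono[OF _ K])
        have "n + n\<^sup>2 \<le> 2 * (1 + n\<^sup>2)" for n :: real
          using zero_le_power2[of "n - 1/2"] by (simp add: power2_diff power_divide)
        then show "?n + ?n\<^sup>2 \<le> 2 * (1 + ?n\<^sup>2)" .
      qed
      finally have "x s \<bullet> ?u \<le> 2 * K * (1 + x s \<bullet> x s)"
        by (simp add: power2_norm_eq_inner algebra_simps)
      then show "(2 * (x s \<bullet> ?u) - 4 * K * (1 + x s \<bullet> x s)) * exp (- 4 * K * s) \<le> 0"
        by (intro mult_nonpos_nonneg) auto
    qed (use t in auto)
    then have "(1 + x t \<bullet> x t) * exp (- 4 * K * t) * exp (4 * K * t) \<le> (1 + x0 \<bullet> x0) * exp (4 * K * t)"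
      by (intro mult_right_mono) (auto simp: N_def x0)
    then have "1 + x t \<bullet> x t \<le> (1 + x0 \<bullet> x0) * exp (4 * K * t)"
      by (simp add: mult.assoc exp_minus_inverse flip: exp_add)
    also have "\<dots> \<le> (1 + x0 \<bullet> x0) * exp (4 * K * T)"
      using t K by (intro mult_left_mono) (auto intro: mult_left_mono)
    finally show ?thesis
      unfolding R_def by (intro real_le_rsqrt) (simp add: power2_norm_eq_inner)
  qed
  show ?thesis
  proof
    show "x 0 = x0" by fact
    fix t assume t: "t \<in> {0..T}"
    show "(x has_vector_derivative f (x t)) (at t within {0..T})"
      using x[OF t] \<pi>_id[OF bound[OF t]] by simp
  qed
qed

section \<open>Fields that are Lipschitz on balls\<close>

text \<open>The closure properties below reduce the Lipschitz condition for a field on a product space to that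
  for its coefficients, which are continuously differentiable functions of one variable.\<close>

lemma lipschitz_on_balls_bounded:
  assumes "lipschitz_on_balls f"
  obtains B where "\<And>z. z \<in> cball 0 R \<Longrightarrow> norm (f z) \<le> B"
proof (cases "0 \<le> R")
  case True
  obtain L where L: "L-lipschitz_on (cball 0 R) f"
    using assms unfolding lipschitz_on_balls_def by blast
  have "norm (f z) \<le> norm (f 0) + L * R" if z: "z \<in> cball 0 R" for z
  proof -
    have "norm (f z) \<le> norm (f 0) + norm (f z - f 0)"
      by (metis add_diff_cancel_left' diff_add_cancel norm_triangle_ineq add.commute)
    also have "norm (f z - f 0) \<le> L * norm (z - 0)"
      using True z by (intro lipschitz_on_normD[OF L]) auto
    also have "\<dots> \<le> L * R"
      using z lipschitz_on_nonneg[OF L] by (intro mult_left_mono) auto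
    finally show ?thesis by simp
  qed
  then show ?thesis by (rule that)
next
  case False
  then show ?thesis by (intro that[of 0]) auto
qed

lemma lipschitz_on_ballsI:
  assumes "L-lipschitz_on UNIV f"
  shows "lipschitz_on_balls f"
  unfolding lipschitz_on_balls_def using assms by (auto intro: lipschitz_on_subset)

lemma lipschitz_on_balls_const: "lipschitz_on_balls (\<lambda>z. c)"
  by (rule lipschitz_on_ballsI[OF lipschitz_on_constant])

lemma lipschitz_on_balls_linear: "bounded_linear f \<Longrightarrow> lipschitz_on_balls f"
  by (metis bounded_linear.lipschitz_boundE lipschitz_on_ballsI)

lemma lipschitz_on_balls_minus: "lipschitz_on_balls f \<Longrightarrow> lipschitz_on_balls (\<lambda>z. - f z)"
  unfolding lipschitz_on_balls_def by (blast intro: lipschitz_on_minus)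

lemma lipschitz_on_balls_diff:
  "lipschitz_on_balls f \<Longrightarrow> lipschitz_on_balls g \<Longrightarrow> lipschitz_on_balls (\<lambda>z. f z - g z)"
  unfolding lipschitz_on_balls_def by (blast intro: lipschitz_on_diff)

lemma lipschitz_on_balls_Pair:
  "lipschitz_on_balls f \<Longrightarrow> lipschitz_on_balls g \<Longrightarrow> lipschitz_on_balls (\<lambda>z. (f z, g z))"
  unfolding lipschitz_on_balls_def by (blast intro: lipschitz_on_Pair)

lemma lipschitz_on_balls_mult:
  fixes f g :: "'a::real_normed_vector \<Rightarrow> real"
  assumes f: "lipschitz_on_balls f" and g: "lipschitz_on_balls g"
  shows "lipschitz_on_balls (\<lambda>z. f z * g z)"
  unfolding lipschitz_on_balls_def
proof
  fix R
  obtain Bf where Bf: "\<And>z. z \<in> cball 0 R \<Longrightarrow> norm (f z) \<le> Bf"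
    using lipschitz_on_balls_bounded[OF f, of R] by blast
  obtain Bg where Bg: "\<And>z. z \<in> cball 0 R \<Longrightarrow> norm (g z) \<le> Bg"
    using lipschitz_on_balls_bounded[OF g, of R] by blast
  obtain Lf Lg where L: "Lf-lipschitz_on (cball 0 R) f" "Lg-lipschitz_on (cball 0 R) g"
    using f g unfolding lipschitz_on_balls_def by blast
  have "(\<bar>Bf\<bar> * Lg + \<bar>Bg\<bar> * Lf)-lipschitz_on (cball 0 R) (\<lambda>z. f z * g z)"
  proof (rule lipschitz_onI)
    show "0 \<le> \<bar>Bf\<bar> * Lg + \<bar>Bg\<bar> * Lf" using L[THEN lipschitz_on_nonneg] by simp
    fix x y :: 'a assume xy: "x \<in> cball 0 R" "y \<in> cball 0 R"
    have "f x * g x - f y * g y = f x * (g x - g y) + g y * (f x - f y)" by (simp add: algebra_simps)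
    then have "dist (f x * g x) (f y * g y) \<le> \<bar>f x\<bar> * \<bar>g x - g y\<bar> + \<bar>g y\<bar> * \<bar>f x - f y\<bar>"
      by (simp add: dist_real_def abs_triangle_ineq flip: abs_mult)
    also have "\<dots> \<le> \<bar>Bf\<bar> * (Lg * dist x y) + \<bar>Bg\<bar> * (Lf * dist x y)"
      using lipschitz_onD[OF L(1) xy] lipschitz_onD[OF L(2) xy] Bf[OF xy(1)] Bg[OF xy(2)]
      by (intro add_mono mult_mono) (auto simp: dist_real_def)
    finally show "dist (f x * g x) (f y * g y) \<le> (\<bar>Bf\<bar> * Lg + \<bar>Bg\<bar> * Lf) * dist x y"
      by (simp add: algebra_simps)
  qed
  then show "\<exists>L. L-lipschitz_on (cball 0 R) (\<lambda>z. f z * g z)" by blast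
qed

lemma lipschitz_on_balls_compose:
  assumes f: "lipschitz_on_balls f" and g: "lipschitz_on_balls g"
  shows "lipschitz_on_balls (\<lambda>z. g (f z))"
  unfolding lipschitz_on_balls_def
proof
  fix R
  obtain B where B: "\<And>z. z \<in> cball 0 R \<Longrightarrow> norm (f z) \<le> B"
    using lipschitz_on_balls_bounded[OF f, of R] by blast
  obtain L where L: "L-lipschitz_on (cball 0 R) f"
    using f unfolding lipschitz_on_balls_def by blast
  obtain M where M: "M-lipschitz_on (cball 0 B) g"
    using g unfolding lipschitz_on_balls_def by blast
  have "f ` cball 0 R \<subseteq> cball 0 B" using B by auto
  then have "(M * L)-lipschitz_on (cball 0 R) (\<lambda>z. g (f z))"
    using lipschitz_on_compose2[OF L lipschitz_on_subset[OF M]] by blast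
  then show "\<exists>L. L-lipschitz_on (cball 0 R) (\<lambda>z. g (f z))" by blast
qed

lemma lipschitz_on_balls_C1:
  fixes f :: "real \<Rightarrow> real"
  assumes der: "\<And>x. (f has_real_derivative f' x) (at x)" and cont: "continuous_on UNIV f'"
  shows "lipschitz_on_balls f"
  unfolding lipschitz_on_balls_def
proof
  fix R
  have "bounded (f' ` cball 0 R)"
    by (intro compact_imp_bounded compact_continuous_image continuous_on_subset[OF cont]) auto
  then obtain B where B: "\<forall>x\<in>cball 0 R. \<bar>f' x\<bar> \<le> B" by (auto simp: bounded_iff)
  have "\<bar>B\<bar>-lipschitz_on (cball 0 R) f"
  proof (rule lipschitz_onI)
    fix x y :: real assume "x \<in> cball 0 R" "y \<in> cball 0 R"
    then show "dist (f x) (f y) \<le> \<bar>B\<bar> * dist x y"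
      using field_differentiable_bound[of "cball 0 R" f f' "\<bar>B\<bar>" x y] B der
      by (force simp: dist_norm intro: has_field_derivative_at_within)
  qed simp
  then show "\<exists>L. L-lipschitz_on (cball 0 R) f" by blast
qed

section \<open>Periodic solutions of reversible fields\<close>

lemma has_vector_derivative_at_join:
  fixes y :: "real \<Rightarrow> 'a::real_normed_vector"
  assumes "a < t" "t < b"
    and l: "(y has_vector_derivative D) (at t within {a..t})"
    and r: "(y has_vector_derivative D) (at t within {t..b})"
  shows "(y has_vector_derivative D) (at t)"
proof -
  have "(y has_vector_derivative D) (at t within {a..t} \<union> {t..b})"
    using l r unfolding has_vector_derivative_def has_derivative_within
    by (auto intro: Lim_Un)
  moreover have "{a..t} \<union> {t..b} = {a..b}" using assms by auto
  ultimately show ?thesis using assms by (simp add: at_within_Icc_at)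
qed

text \<open>If \<open>z\<close> solves the equation on \<open>[0, \<tau>]\<close>, then so does \<open>t \<mapsto> \<rho> (z (\<tau> - t))\<close>, because the reversal of time
  and \<open>\<rho>\<close> each change the sign of the field. Traversing the two arcs alternately on the intervals
  \<open>[n \<tau>, (n + 1) \<tau>]\<close> gives a solution on the line: consecutive arcs agree at the common
  end points since \<open>\<rho>\<close> fixes \<open>z 0\<close> and \<open>z \<tau>\<close>, and one-sided derivatives that are both the value
  of the field fit together.\<close>

lemma reflected_arc_periodic_solution:
  fixes X :: "'a::real_normed_vector \<Rightarrow> 'a"
  assumes \<tau>: "0 < \<tau>" and \<rho>: "bounded_linear \<rho>" and rev: "\<And>a. X (\<rho> a) = - \<rho> (X a)"
    and z: "\<And>t. t \<in> {0..\<tau>} \<Longrightarrow> (z has_vector_derivative X (z t)) (at t within {0..\<tau>})"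
    and fix0: "\<rho> (z 0) = z 0" and fix\<tau>: "\<rho> (z \<tau>) = z \<tau>"
  shows "\<exists>y. (\<forall>t. (y has_vector_derivative X (y t)) (at t)) \<and> (\<forall>t. y (t + 2 * \<tau>) = y t) \<and>
     y 0 = z 0 \<and> (\<forall>t. \<exists>s\<in>{0..\<tau>}. y t = z s \<or> y t = \<rho> (z s))"
proof -
  define S where "S n t = (if even n then z (t - of_int n * \<tau>) else \<rho> (z ((of_int n + 1) * \<tau> - t)))"
    for n :: int and t
  define y where "y t = S \<lfloor>t / \<tau>\<rfloor> t" for t
  define J where "J n = {of_int n * \<tau>..(of_int n + 1) * \<tau>}" for n :: int
  have fl: "of_int \<lfloor>t / \<tau>\<rfloor> * \<tau> \<le> t" "t < (of_int \<lfloor>t / \<tau>\<rfloor> + 1) * \<tau>" for t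
    using mult_right_mono[OF of_int_floor_le[of "t / \<tau>"], of \<tau>]
      mult_strict_right_mono[OF real_of_int_floor_add_one_gt[of "t / \<tau>"], of \<tau>] \<tau>
    by simp_all
  have J_floor: "t \<in> J \<lfloor>t / \<tau>\<rfloor>" for t
    using fl[of t] by (simp add: J_def)
  have y_on_J: "y t = S n t" if t: "t \<in> J n" for n t
  proof (cases "t = (of_int n + 1) * \<tau>")
    case True
    then have "\<lfloor>t / \<tau>\<rfloor> = n + 1" using \<tau> by simp
    then show ?thesis
      using True fix0 fix\<tau> by (auto simp: y_def S_def algebra_simps)
  next
    case False
    then have "\<lfloor>t / \<tau>\<rfloor> = n"
      using t \<tau> by (intro floor_unique) (auto simp: J_def field_simps)
    then show ?thesis by (simp add: y_def)
  qed
  have S_der: "(S n has_vector_derivative X (S n t)) (at t within J n)" if t: "t \<in> J n" for n t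
  proof (cases "even n")
    case True
    let ?g = "\<lambda>t. t - of_int n * \<tau>"
    have "(?g has_vector_derivative 1) (at t within J n)"
      by (auto intro!: derivative_eq_intros simp flip: has_real_derivative_iff_has_vector_derivative)
    moreover have "(z has_vector_derivative X (z (?g t))) (at (?g t) within ?g ` J n)"
      using t by (intro has_vector_derivative_within_subset[OF z]) (auto simp: J_def algebra_simps)
    ultimately have "(z \<circ> ?g has_vector_derivative 1 *\<^sub>R X (z (?g t))) (at t within J n)"
      by (rule vector_diff_chain_within)
    then show ?thesis using True by (simp add: S_def[abs_def] o_def)
  next
    case False
    let ?g = "\<lambda>t. (of_int n + 1) * \<tau> - t"
    have "(?g has_vector_derivative - 1) (at t within J n)"
      by (auto intro!: derivative_eq_intros simp flip: has_real_derivative_iff_has_vector_derivative)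
    moreover have "(z has_vector_derivative X (z (?g t))) (at (?g t) within ?g ` J n)"
      using t by (intro has_vector_derivative_within_subset[OF z]) (auto simp: J_def algebra_simps)
    ultimately have "(z \<circ> ?g has_vector_derivative (- 1) *\<^sub>R X (z (?g t))) (at t within J n)"
      by (rule vector_diff_chain_within)
    then have "((\<lambda>t. \<rho> ((z \<circ> ?g) t)) has_vector_derivative \<rho> ((- 1) *\<^sub>R X (z (?g t)))) (at t within J n)"
      by (rule bounded_linear.has_vector_derivative[OF \<rho>])
    moreover have "\<rho> ((- 1) *\<^sub>R X (z (?g t))) = X (\<rho> (z (?g t)))"
      using linear_neg[OF bounded_linear.linear[OF \<rho>]] by (simp add: rev)
    ultimately show ?thesis using False by (simp add: S_def[abs_def] o_def)
  qed
  have y_der: "(y has_vector_derivative X (y t)) (at t within J n)" if t: "t \<in> J n" for n t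
    unfolding y_on_J[OF t] by (rule has_vector_derivative_transform[OF t y_on_J S_der[OF t]])
  show ?thesis
  proof (intro exI[of _ y] conjI allI)
    fix t
    define n where "n = \<lfloor>t / \<tau>\<rfloor>"
    have n: "of_int n * \<tau> \<le> t" "t < (of_int n + 1) * \<tau>"
      using fl[of t] by (simp_all add: n_def)
    show "(y has_vector_derivative X (y t)) (at t)"
    proof (cases "t = of_int n * \<tau>")
      case True
      have "J (n - 1) = {(of_int n - 1) * \<tau>..t}" "J n = {t..(of_int n + 1) * \<tau>}"
        using True by (auto simp: J_def)
      moreover have "(of_int n - 1) * \<tau> < t" using True \<tau> by (simp add: algebra_simps)
      ultimately show ?thesis
        using n y_der[of t "n - 1"] y_der[of t n]
        by (intro has_vector_derivative_at_join[of "(of_int n - 1) * \<tau>" t "(of_int n + 1) * \<tau>"]) auto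
    next
      case False
      then have "at t within J n = at t"
        unfolding J_def using n by (intro at_within_Icc_at) auto
      then show ?thesis using y_der[of t n] J_floor[of t] by (simp add: n_def)
    qed
    have "(t + 2 * \<tau>) / \<tau> = t / \<tau> + of_int 2" using \<tau> by (simp add: field_simps)
    then have "\<lfloor>(t + 2 * \<tau>) / \<tau>\<rfloor> = \<lfloor>t / \<tau>\<rfloor> + 2" by (simp only: floor_add_int)
    then show "y (t + 2 * \<tau>) = y t" by (simp add: y_def S_def algebra_simps)
    have "t - of_int n * \<tau> \<in> {0..\<tau>}" "(of_int n + 1) * \<tau> - t \<in> {0..\<tau>}"
      using n by (auto simp: algebra_simps)
    then show "\<exists>s\<in>{0..\<tau>}. y t = z s \<or> y t = \<rho> (z s)"
      unfolding y_def S_def n_def[symmetric] by auto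
    show "y 0 = z 0" by (simp add: y_def S_def)
  qed
qed

section \<open>Spring oscillators with a bounded reversible perturbation\<close>

text \<open>A spring oscillator whose inertia \<open>1 / q\<^sup>2\<close> depends on the position, coupled to a
  momentum \<open>p\<close> whose rate of change is bounded.\<close>

locale reversible_oscillator =
  fixes k :: real and q h g f :: "real \<Rightarrow> real" and q0 q1 C :: real
  assumes k: "0 < k" and q0: "0 < q0"
    and q_ge: "\<And>x. q0 \<le> q x" and q_le: "\<And>x. q x \<le> q1"
    and h_le: "\<And>x. \<bar>h x\<bar> \<le> C" and g_le: "\<And>x. \<bar>g x\<bar> \<le> C" and f_le: "\<And>x. \<bar>f x\<bar> \<le> C"
    and q_even: "\<And>x. q (- x) = q x" and h_odd: "\<And>x. h (- x) = - h x"
    and g_odd: "\<And>x. g (- x) = - g x" and f_odd: "\<And>x. f (- x) = - f x"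
    and lip: "lipschitz_on_balls q" "lipschitz_on_balls h" "lipschitz_on_balls g"
      "lipschitz_on_balls f"
begin

definition field :: "state \<Rightarrow> state" where
  "field = (\<lambda>(\<phi>, w, p). (q \<phi> * w, q \<phi> * (h \<phi> - k * \<phi> - g \<phi> * p\<^sup>2), - f \<phi>))"

definition reflection :: "state \<Rightarrow> state" where
  "reflection = (\<lambda>(\<phi>, w, p). (- \<phi>, w, p))"

lemma field_reflection: "field (reflection a) = - reflection (field a)"
  by (cases a) (simp add: field_def reflection_def q_even h_odd g_odd f_odd algebra_simps)

lemma bounded_linear_reflection: "bounded_linear reflection"
proof -
  have "bounded_linear (\<lambda>a :: state. (- fst a, snd a))"
    by (intro bounded_linear_Pair bounded_linear_minus bounded_linear_fst bounded_linear_snd)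
  then show ?thesis by (simp add: reflection_def case_prod_unfold)
qed

lemma q_pos: "0 < q x"
  using q0 q_ge[of x] by linarith

lemma C_nonneg: "0 \<le> C"
  using f_le[of 0] by linarith

text \<open>The term quadratic in \<open>p\<close> violates linear growth. Since \<open>p'\<close> is bounded by \<open>C\<close>, the
  momentum, which starts in \<open>[- 1, 1]\<close>, cannot leave \<open>[- P, P]\<close> with \<open>P = 1 + C T\<close> before time \<open>T\<close>; clamping it there restores
  linear growth without changing the solution.\<close>

lemma integral_curve:
  assumes T: "0 \<le> T" and p0: "\<bar>p0\<bar> \<le> 1"
  shows "\<exists>\<phi> w p. \<phi> 0 = 0 \<and> w 0 = W \<and> p 0 = p0 \<and> (\<forall>t\<in>{0..T}.
      (\<phi> has_real_derivative q (\<phi> t) * w t) (at t within {0..T}) \<and>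
      (w has_real_derivative q (\<phi> t) * (h (\<phi> t) - k * \<phi> t - g (\<phi> t) * (p t)\<^sup>2)) (at t within {0..T}) \<and>
      (p has_real_derivative - f (\<phi> t)) (at t within {0..T}) \<and> \<bar>p t\<bar> \<le> 1 + C * T)"
proof -
  define P where "P = 1 + C * T"
  have P: "1 \<le> P" using C_nonneg T by (simp add: P_def)
  define cl where "cl p = max (- P) (min P p)" for p :: real
  define Y :: "state \<Rightarrow> state" where "Y a = (q (fst a) * fst (snd a),
      q (fst a) * (h (fst a) - k * fst a - g (fst a) * (cl (snd (snd a)) * cl (snd (snd a)))), - f (fst a))" for a
  have lin: "lipschitz_on_balls (\<lambda>a :: state. fst a)" "lipschitz_on_balls (\<lambda>a :: state. fst (snd a))"
    "lipschitz_on_balls (\<lambda>a :: state. snd (snd a))"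
    by (intro lipschitz_on_balls_linear bounded_linear_intros)+
  have cl_lip: "lipschitz_on_balls cl"
    by (intro lipschitz_on_ballsI[of 1] lipschitz_onI) (auto simp: cl_def dist_real_def)
  have Y_lip: "lipschitz_on_balls Y"
    unfolding Y_def[abs_def]
    by (intro lipschitz_on_balls_Pair lipschitz_on_balls_mult lipschitz_on_balls_diff
        lipschitz_on_balls_minus lipschitz_on_balls_const lin
        lipschitz_on_balls_compose[OF lin(1) lip(1)] lipschitz_on_balls_compose[OF lin(1) lip(2)]
        lipschitz_on_balls_compose[OF lin(1) lip(3)] lipschitz_on_balls_compose[OF lin(1) lip(4)]
        lipschitz_on_balls_compose[OF lin(3) cl_lip])
  have q1: "0 < q1" using q_pos[of 0] q_le[of 0] by linarith
  define D where "D = C + C * P\<^sup>2"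
  have D: "\<bar>h x - g x * (cl p * cl p)\<bar> \<le> D" for x p
  proof -
    have "\<bar>cl p\<bar> \<le> P" using P by (auto simp: cl_def)
    then have "\<bar>g x\<bar> * (\<bar>cl p\<bar> * \<bar>cl p\<bar>) \<le> C * (P * P)"
      using g_le[of x] P C_nonneg by (intro mult_mono) auto
    then have "\<bar>g x * (cl p * cl p)\<bar> \<le> C * P\<^sup>2" by (simp add: abs_mult power2_eq_square)
    then show ?thesis using h_le[of x] by (simp add: D_def)
  qed
  have growth: "norm (Y a) \<le> (q1 + q1 * (D + k) + C) * (1 + norm a)" for a
  proof -
    obtain \<phi> w p where a: "a = (\<phi>, w, p)" by (cases a) auto
    let ?n = "norm a"
    have n: "\<bar>\<phi>\<bar> \<le> ?n" "\<bar>w\<bar> \<le> ?n"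
      using norm_fst_le[of \<phi> "(w, p)"]
        order_trans[OF norm_fst_le[of w p] norm_snd_le[of "(w, p)" \<phi>]] by (simp_all add: a)
    let ?B = "h \<phi> - g \<phi> * (cl p * cl p)"
    have "\<bar>q \<phi> * w\<bar> \<le> q1 * (1 + ?n)"
      using q_le[of \<phi>] q_pos[of \<phi>] n by (simp add: abs_mult) (intro mult_mono, auto)
    moreover have "\<bar>q \<phi> * (h \<phi> - k * \<phi> - g \<phi> * (cl p * cl p))\<bar> \<le> q1 * ((D + k) * (1 + ?n))"
    proof -
      have "\<bar>k * \<phi>\<bar> \<le> k * ?n" using n k by (simp add: abs_mult)
      then have "\<bar>?B - k * \<phi>\<bar> \<le> D + k * ?n"
        using D[of \<phi> p] abs_triangle_ineq4[of ?B "k * \<phi>"] by linarith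
      moreover have "0 \<le> D * ?n" using D[of 0 0] by (intro mult_nonneg_nonneg) auto
      ultimately have "\<bar>?B - k * \<phi>\<bar> \<le> (D + k) * (1 + ?n)"
        using k by (simp only: ring_distribs)
      then have "q \<phi> * \<bar>?B - k * \<phi>\<bar> \<le> q1 * ((D + k) * (1 + ?n))"
        using q_le[of \<phi>] q_pos[of \<phi>] by (intro mult_mono) auto
      moreover have "h \<phi> - k * \<phi> - g \<phi> * (cl p * cl p) = ?B - k * \<phi>" by simp
      ultimately show ?thesis using q_pos[of \<phi>] by (simp only: abs_mult abs_of_pos)
    qed
    moreover have "\<bar>- f \<phi>\<bar> \<le> C * (1 + ?n)"
    proof -
      have "C * 1 \<le> C * (1 + ?n)" using C_nonneg by (intro mult_left_mono) auto
      then show ?thesis using f_le[of \<phi>] by simp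
    qed
    moreover have "norm (Y a) \<le> \<bar>q \<phi> * w\<bar> + (\<bar>q \<phi> * (h \<phi> - k * \<phi> - g \<phi> * (cl p * cl p))\<bar> + \<bar>- f \<phi>\<bar>)"
      unfolding Y_def a fst_conv snd_conv
      by (intro order_trans[OF norm_Pair_le] add_mono) auto
    ultimately show ?thesis by (simp add: algebra_simps)
  qed
  obtain z where z0: "z 0 = (0, W, p0)"
    and z: "\<And>t. t \<in> {0..T} \<Longrightarrow> (z has_vector_derivative Y (z t)) (at t within {0..T})"
    using linear_growth_integral_curve[OF Y_lip growth T, of "(0, W, p0)"] by blast
  let ?\<phi> = "\<lambda>t. fst (z t)" and ?w = "\<lambda>t. fst (snd (z t))" and ?p = "\<lambda>t. snd (snd (z t))"
  have \<phi>': "(?\<phi> has_real_derivative q (?\<phi> t) * ?w t) (at t within {0..T})"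
    and w': "(?w has_real_derivative q (?\<phi> t) * (h (?\<phi> t) - k * ?\<phi> t - g (?\<phi> t) * (cl (?p t) * cl (?p t))))
        (at t within {0..T})"
    and p': "(?p has_real_derivative - f (?\<phi> t)) (at t within {0..T})" if "t \<in> {0..T}" for t
  proof -
    have lin: "bounded_linear (\<lambda>a :: state. fst a)" "bounded_linear (\<lambda>a :: state. fst (snd a))"
      "bounded_linear (\<lambda>a :: state. snd (snd a))"
      by (intro bounded_linear_intros)+
    note d = lin[THEN bounded_linear.has_vector_derivative, OF z[OF that]]
    show "(?\<phi> has_real_derivative q (?\<phi> t) * ?w t) (at t within {0..T})"
      "(?w has_real_derivative q (?\<phi> t) * (h (?\<phi> t) - k * ?\<phi> t - g (?\<phi> t) * (cl (?p t) * cl (?p t))))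
        (at t within {0..T})"
      "(?p has_real_derivative - f (?\<phi> t)) (at t within {0..T})"
      using d by (simp_all add: Y_def has_real_derivative_iff_has_vector_derivative)
  qed
  have p_le: "\<bar>?p t\<bar> \<le> P" if t: "t \<in> {0..T}" for t
  proof -
    have d: "(?p has_real_derivative - f (?\<phi> s)) (at s within {0..t})" if "s \<in> {0..t}" for s
      by (rule DERIV_subset[OF p']) (use that t in auto)
    have "?p t - ?p 0 \<le> C * (t - 0)"
      by (rule increment_le_of_derivative_le[OF _ d]) (use t f_le abs_le_D2 in auto)
    moreover have "- ?p t - - ?p 0 \<le> C * (t - 0)"
      by (rule increment_le_of_derivative_le[OF _ DERIV_minus[OF d]]) (use t f_le abs_le_D1 in auto)
    moreover have "C * t \<le> C * T" using t C_nonneg by (intro mult_left_mono) auto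
    ultimately show ?thesis using p0 by (simp add: P_def z0)
  qed
  then have cl: "cl (?p t) * cl (?p t) = (?p t)\<^sup>2" if "t \<in> {0..T}" for t
  proof -
    have "cl (?p t) = ?p t" using p_le[OF that] by (auto simp: cl_def)
    then show ?thesis by (simp only: power2_eq_square)
  qed
  have "?\<phi> 0 = 0" "?w 0 = W" "?p 0 = p0" by (simp_all add: z0)
  moreover have "\<bar>?p t\<bar> \<le> 1 + C * T" if "t \<in> {0..T}" for t
    using p_le[OF that] by (simp add: P_def)
  moreover have "(?w has_real_derivative q (?\<phi> t) * (h (?\<phi> t) - k * ?\<phi> t - g (?\<phi> t) * (?p t)\<^sup>2))
        (at t within {0..T})" if "t \<in> {0..T}" for t
    using w'[OF that] by (simp only: cl[OF that])
  ultimately show ?thesis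
    using \<phi>' p' by (intro exI[of _ ?\<phi>] exI[of _ ?w] exI[of _ ?p] conjI ballI) simp_all
qed

text \<open>With \<open>u = sqrt k \<phi>\<close> and the bounded force \<open>B = h - g p\<^sup>2\<close>, the plane vector \<open>(u, w)\<close> obeys
  \<open>u' = q sqrt k w\<close>, \<open>w' = q (B - sqrt k u)\<close>. Its length changes at a bounded rate, so it stays
  large over a fixed time if it starts large; then \<open>B\<close> is negligible against \<open>sqrt k u\<close>, and the polar
  angle decreases at least at the rate \<open>\<kappa>\<close>, half a lower bound for the unperturbed rate. If \<open>u\<close>
  stayed positive, the angle \<open>arctan (w / u)\<close> would drop by more than \<open>\<pi>\<close>, which is
  impossible.\<close>

lemma return_to_section:
  "\<exists>W0>0. \<forall>W p0. W0 < W \<and> \<bar>p0\<bar> \<le> 1 \<longrightarrow>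
     (\<exists>\<tau>>0. \<exists>z. z 0 = (0, W, p0) \<and> fst (z \<tau>) = 0 \<and> (\<forall>t\<in>{0<..<\<tau>}. 0 < fst (z t)) \<and>
       (\<forall>t\<in>{0..\<tau>}. (z has_vector_derivative field (z t)) (at t within {0..\<tau>})))"
proof -
  define \<kappa> where "\<kappa> = sqrt k * q0 / 2"
  define T where "T = 2 * pi / \<kappa>"
  define D where "D = C + C * (1 + C * T)\<^sup>2"
  \<comment> \<open>Up to time \<open>T\<close> the length drops by at most \<open>q1 D T\<close>, and \<open>D\<close> is at most half of \<open>sqrt k\<close> times the
    length as long as the length is at least \<open>2 D / sqrt k\<close>.\<close>
  define W0 where "W0 = 1 + 2 * D / sqrt k + q1 * D * T"
  have \<kappa>: "0 < \<kappa>" using k q0 by (simp add: \<kappa>_def)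
  have T: "0 < T" using \<kappa> by (simp add: T_def)
  have D: "0 \<le> D" using C_nonneg by (simp add: D_def)
  have q1: "0 < q1" using q_pos[of 0] q_le[of 0] by linarith
  have sk: "0 < sqrt k" "sqrt k * sqrt k = k" using k by auto
  have W0: "0 < W0"
    unfolding W0_def using D sk T q1 by (intro add_pos_nonneg) auto
  have "\<exists>\<tau>>0. \<exists>z. z 0 = (0, W, p0) \<and> fst (z \<tau>) = 0 \<and> (\<forall>t\<in>{0<..<\<tau>}. 0 < fst (z t)) \<and>
      (\<forall>t\<in>{0..\<tau>}. (z has_vector_derivative field (z t)) (at t within {0..\<tau>}))"
    if W: "W0 < W" and p0: "\<bar>p0\<bar> \<le> 1" for W p0
  proof -
    obtain \<phi> w p where init: "\<phi> 0 = 0" "w 0 = W" "p 0 = p0"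
      and ode: "\<forall>t\<in>{0..T}.
      (\<phi> has_real_derivative q (\<phi> t) * w t) (at t within {0..T}) \<and>
      (w has_real_derivative q (\<phi> t) * (h (\<phi> t) - k * \<phi> t - g (\<phi> t) * (p t)\<^sup>2)) (at t within {0..T}) \<and>
      (p has_real_derivative - f (\<phi> t)) (at t within {0..T}) \<and> \<bar>p t\<bar> \<le> 1 + C * T"
      using integral_curve[OF less_imp_le[OF T] p0, of W] by blast
    note \<phi>' = ode[rule_format, THEN conjunct1]
      and w' = ode[rule_format, THEN conjunct2, THEN conjunct1]
      and p' = ode[rule_format, THEN conjunct2, THEN conjunct2, THEN conjunct1]
      and p_le = ode[rule_format, THEN conjunct2, THEN conjunct2, THEN conjunct2]
    define B where "B t = h (\<phi> t) - g (\<phi> t) * (p t)\<^sup>2" for t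
    have B: "\<bar>B t\<bar> \<le> D" if "t \<in> {0..T}" for t
    proof -
      have "\<bar>g (\<phi> t)\<bar> * \<bar>p t\<bar>\<^sup>2 \<le> C * (1 + C * T)\<^sup>2"
        using g_le p_le[OF that] C_nonneg by (intro mult_mono power_mono) auto
      then show ?thesis
        using h_le[of "\<phi> t"] abs_triangle_ineq4[of "h (\<phi> t)" "g (\<phi> t) * (p t)\<^sup>2"]
        by (simp add: B_def D_def abs_mult)
    qed
    have w'B: "(w has_real_derivative q (\<phi> t) * (B t - k * \<phi> t)) (at t within {0..T})"
      if "t \<in> {0..T}" for t
      using w'[OF that] by (simp add: B_def algebra_simps)
    \<comment> \<open>The summand 1 keeps the square root differentiable.\<close>
    define r where "r t = sqrt (1 + (k * (\<phi> t)\<^sup>2 + (w t)\<^sup>2))" for t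
    have pos: "0 < 1 + (k * (\<phi> t)\<^sup>2 + (w t)\<^sup>2)" for t
      using k by (intro add_pos_nonneg) auto
    have r_ge: "1 + 2 * D / sqrt k \<le> r t" if t: "t \<in> {0..T}" for t
    proof -
      have "- r t - - r 0 \<le> q1 * D * (t - 0)"
      proof (rule increment_le_of_derivative_le[where f = "\<lambda>s. - r s"
            and f' = "\<lambda>s. - (q (\<phi> s) * w s * B s / r s)"])
        fix s assume s: "s \<in> {0..t}"
        then have sT: "s \<in> {0..T}" using t by simp
        have d: "(\<phi> has_real_derivative q (\<phi> s) * w s) (at s within {0..t})"
          "(w has_real_derivative q (\<phi> s) * (B s - k * \<phi> s)) (at s within {0..t})"
          using DERIV_subset[OF \<phi>'[OF sT]] DERIV_subset[OF w'B[OF sT]] t by simp_all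
        show "((\<lambda>s. - r s) has_real_derivative - (q (\<phi> s) * w s * B s / r s)) (at s within {0..t})"
        proof -
          let ?E = "\<lambda>s. 1 + (k * (\<phi> s)\<^sup>2 + (w s)\<^sup>2)"
          have "(?E has_real_derivative 2 * (q (\<phi> s) * w s * B s)) (at s within {0..t})"
            by (rule derivative_eq_intros d refl)+ (simp add: algebra_simps)
          note DERIV_chain2[where f = sqrt and g = ?E, OF DERIV_real_sqrt[OF pos[of s]] this]
          from DERIV_minus[OF this]
          show ?thesis unfolding r_def by (rule DERIV_cong) (simp add: field_simps)
        qed
        have "\<bar>w s\<bar> \<le> r s"
          unfolding r_def by (rule real_le_rsqrt) (use k in simp)
        then have "\<bar>q (\<phi> s)\<bar> * \<bar>w s\<bar> * \<bar>B s\<bar> \<le> q1 * r s * D"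
          using q_le[of "\<phi> s"] q_pos[of "\<phi> s"] B[OF sT] D q1
          by (intro mult_mono) auto
        then have "- (q (\<phi> s) * w s * B s) \<le> q1 * D * r s"
          using abs_ge_minus_self[of "q (\<phi> s) * w s * B s"] by (simp add: abs_mult mult.commute mult.left_commute)
        moreover have "0 < r s" using pos[of s] by (simp add: r_def)
        ultimately show "- (q (\<phi> s) * w s * B s / r s) \<le> q1 * D"
          by (simp only: minus_divide_left pos_divide_le_eq)
      qed (use t in auto)
      moreover have "q1 * D * t \<le> q1 * D * T" using t q1 D by (intro mult_left_mono) auto
      moreover have "W \<le> r 0" unfolding r_def init by (rule real_le_rsqrt) simp
      ultimately show ?thesis using W by (simp add: W0_def)
    qed
    \<comment> \<open>The angle is undefined at time 0, where \<open>\<phi> = 0\<close>; the last three quarters of \<open>[0, T]\<close> already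
      account for a rotation by \<open>3/2 \<pi>\<close>.\<close>
    have turn: "\<exists>t\<in>{T / 4..T}. \<phi> t \<le> 0"
    proof (rule ccontr)
      assume "\<not> ?thesis"
      then have \<phi>_pos: "0 < \<phi> t" if "t \<in> {T / 4..T}" for t using that by force
      define \<theta> where "\<theta> t = arctan (w t / (sqrt k * \<phi> t))" for t
      have "\<theta> T - \<theta> (T / 4) \<le> - \<kappa> * (T - T / 4)"
      proof (rule increment_le_of_derivative_le[where f = \<theta> and f' = "\<lambda>s. (q (\<phi> s) *
            (B s - k * \<phi> s) * (sqrt k * \<phi> s) - w s * (sqrt k * (q (\<phi> s) * w s))) /
            (k * (\<phi> s)\<^sup>2 + (w s)\<^sup>2)"])
        fix s assume s: "s \<in> {T / 4..T}"
        then have sT: "s \<in> {0..T}" using T by auto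
        have d: "(\<phi> has_real_derivative q (\<phi> s) * w s) (at s within {T / 4..T})"
          "(w has_real_derivative q (\<phi> s) * (B s - k * \<phi> s)) (at s within {T / 4..T})"
          using T by (auto intro!: DERIV_subset[OF \<phi>'[OF sT]] DERIV_subset[OF w'B[OF sT]])
        let ?u = "sqrt k * \<phi> s" and ?N = "k * (\<phi> s)\<^sup>2 + (w s)\<^sup>2"
        have u: "0 < ?u" using sk \<phi>_pos[OF s] by simp
        have u2: "?u\<^sup>2 = k * (\<phi> s)\<^sup>2" using k by (simp add: power_mult_distrib)
        have N: "0 < ?N" using u2 u by (metis add_pos_nonneg zero_le_power2 zero_less_power)
        have arctan_factor: "inverse (1 + (x / y)\<^sup>2) * (e / (y * y)) = e / (y\<^sup>2 + x\<^sup>2)"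
          if "0 < y" for x y e :: real
        proof -
          have "1 + (x / y)\<^sup>2 = (y\<^sup>2 + x\<^sup>2) / (y * y)"
            using that by (simp add: power_divide add_divide_distrib power2_eq_square)
          then show ?thesis using that by simp
        qed
        show "(\<theta> has_real_derivative (q (\<phi> s) * (B s - k * \<phi> s) * ?u - w s * (sqrt k * (q (\<phi> s) * w s))) / ?N)
            (at s within {T / 4..T})"
        proof -
          note DERIV_divide[OF d(2) DERIV_cmult[OF d(1), of "sqrt k"] less_imp_neq[OF u, symmetric]]
          note DERIV_chain2[where f = arctan and g = "\<lambda>t. w t / (sqrt k * \<phi> t)", OF DERIV_arctan this]
          then show ?thesis unfolding \<theta>_def arctan_factor[OF u] u2 .
        qed
        have "2 * D / sqrt k \<le> sqrt ?N"
        proof (rule real_le_rsqrt)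
          have "(2 * D / sqrt k)\<^sup>2 + 1 \<le> (1 + 2 * D / sqrt k)\<^sup>2"
            using D sk by (simp add: power2_sum)
          also have "\<dots> \<le> (r s)\<^sup>2" using r_ge[OF sT] D sk by (intro power_mono) auto
          also have "\<dots> = 1 + ?N" using pos[of s] by (simp add: r_def)
          finally show "(2 * D / sqrt k)\<^sup>2 \<le> ?N" by simp
        qed
        then have DN: "2 * D \<le> sqrt k * sqrt ?N" using sk by (simp add: field_simps)
        have "?u \<le> sqrt ?N" by (intro real_le_rsqrt) (simp add: u2)
        then have "B s * ?u \<le> D * sqrt ?N"
          using B[OF sT] u D by (intro mult_mono) auto
        then have "2 * (B s * ?u) \<le> 2 * D * sqrt ?N" by simp
        also have "\<dots> \<le> sqrt k * sqrt ?N * sqrt ?N"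
          by (rule mult_right_mono[OF DN]) (use N in simp)
        also have "\<dots> = sqrt k * ?N" using N by simp
        finally have Bu: "B s * ?u - sqrt k * ?N \<le> - (sqrt k / 2 * ?N)" by simp
        have "q (\<phi> s) * (B s - k * \<phi> s) * ?u - w s * (sqrt k * (q (\<phi> s) * w s))
            = q (\<phi> s) * (B s * ?u - sqrt k * ?N)"
          by (simp add: algebra_simps power2_eq_square)
        also have "\<dots> \<le> q (\<phi> s) * - (sqrt k / 2 * ?N)"
          using Bu q_pos[of "\<phi> s"] by (intro mult_left_mono) auto
        also have "\<dots> \<le> - (q0 * (sqrt k / 2 * ?N))"
          using mult_right_mono[OF q_ge[of "\<phi> s"], of "sqrt k / 2 * ?N"] sk N by simp
        also have "\<dots> = - \<kappa> * ?N" unfolding \<kappa>_def by (simp add: field_simps)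
        finally show "(q (\<phi> s) * (B s - k * \<phi> s) * ?u - w s * (sqrt k * (q (\<phi> s) * w s))) / ?N \<le> - \<kappa>"
          using N by (simp add: pos_divide_le_eq)
      qed (use T in auto)
      also have "- \<kappa> * (T - T / 4) = - (3 / 2 * pi)" using \<kappa> by (simp add: T_def field_simps)
      finally have "\<theta> T - \<theta> (T / 4) \<le> - (3 / 2 * pi)" .
      moreover have "- (pi / 2) < \<theta> T" "\<theta> (T / 4) < pi / 2"
        unfolding \<theta>_def by (rule arctan_lbound arctan_ubound)+
      ultimately show False using pi_gt_zero by linarith
    qed
    obtain t1 where t1: "t1 \<in> {T / 4..T}" "\<phi> t1 \<le> 0" using turn by blast
    have cont: "continuous_on {0..T} \<phi>"
      by (rule DERIV_continuous_on[OF \<phi>'])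
    obtain \<delta> where \<delta>: "0 < \<delta>" and up: "\<And>t. 0 < t \<Longrightarrow> t \<le> T \<Longrightarrow> t < \<delta> \<Longrightarrow> 0 < \<phi> t"
      using has_real_derivative_pos_inc_right[OF \<phi>'[of 0]] T q_pos[of 0] W W0
      by (force simp: init)
    define b where "b = min (\<delta> / 2) (T / 8)"
    have b: "0 < b" "b < \<delta>" "b < t1" "b \<le> T" using \<delta> T t1 by (auto simp: b_def min_def)
    define Z where "Z = {t \<in> {b..t1}. \<phi> t \<le> 0}"
    have cont1: "continuous_on {b..t1} \<phi>" by (rule continuous_on_subset[OF cont]) (use b t1 in auto)
    have "Z = {b..t1} \<inter> \<phi> -` {..0}" by (auto simp: Z_def)
    then have "closed Z" using continuous_closed_preimage[OF cont1] by simp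
    moreover have "bounded Z" by (rule bounded_subset[of "{b..t1}"]) (auto simp: Z_def)
    ultimately have "compact Z" by (simp add: compact_eq_bounded_closed)
    moreover have "t1 \<in> Z" using b t1 by (simp add: Z_def)
    ultimately obtain \<tau> where \<tau>: "\<tau> \<in> Z" "\<And>t. t \<in> Z \<Longrightarrow> \<tau> \<le> t"
      using compact_attains_inf[of Z] by blast
    have \<tau>T: "0 < \<tau>" "b \<le> \<tau>" "\<tau> \<le> t1" "\<tau> \<le> T" "\<phi> \<tau> \<le> 0" using \<tau>(1) b t1 by (auto simp: Z_def)
    have above: "0 < \<phi> t" if "t \<in> {0<..<\<tau>}" for t
    proof (cases "t < b")
      case True then show ?thesis using that up b by auto
    next
      case False then show ?thesis using that \<tau>(2)[of t] \<tau>T by (force simp: Z_def)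
    qed
    have "\<phi> \<tau> = 0"
    proof -
      have "0 < \<phi> b" using up b by auto
      then obtain s where "b \<le> s" "s \<le> \<tau>" "\<phi> s = 0"
        using IVT2'[of \<phi> \<tau> 0 b] \<tau>T continuous_on_subset[OF cont1, of "{b..\<tau>}"] by auto
      then show ?thesis using above[of s] b by force
    qed
    define z where "z t = (\<phi> t, w t, p t)" for t
    have "(z has_vector_derivative field (z t)) (at t within {0..\<tau>})" if "t \<in> {0..\<tau>}" for t
    proof -
      have t: "t \<in> {0..T}" using that \<tau>T by auto
      have "(z has_vector_derivative field (z t)) (at t within {0..T})"
        unfolding z_def field_def
        using \<phi>'[OF t] w'[OF t] p'[OF t]
        by (auto intro!: has_vector_derivative_Pair simp: has_real_derivative_iff_has_vector_derivative)
      then show ?thesis by (rule has_vector_derivative_within_subset) (use \<tau>T in auto)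
    qed
    then show ?thesis
      using \<tau>T \<open>\<phi> \<tau> = 0\<close> above init by (intro exI[of _ \<tau>] exI[of _ z] conjI) (auto simp: z_def)
  qed
  then show ?thesis using W0 by blast
qed

text \<open>The last clause separates the orbits. On the arc \<open>z\<close> and its mirror image, \<open>\<phi>\<close> vanishes only at
  the two end points, and at the far one \<open>w\<close> is not positive because \<open>\<phi>\<close> comes down to 0 there.\<close>

theorem periodic_orbits:
  "\<exists>W0>0. \<forall>W p0. W0 < W \<and> \<bar>p0\<bar> \<le> 1 \<longrightarrow>
     (\<exists>y. solution field y \<and> y 0 = (0, W, p0) \<and> periodic y \<and>
          (\<forall>t. fst (y t) = 0 \<and> 0 < fst (snd (y t)) \<longrightarrow> y t = (0, W, p0)))"
proof -
  obtain W0 where W0: "0 < W0" and return: "\<forall>W p0. W0 < W \<and> \<bar>p0\<bar> \<le> 1 \<longrightarrow>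
     (\<exists>\<tau>>0. \<exists>z. z 0 = (0, W, p0) \<and> fst (z \<tau>) = 0 \<and> (\<forall>t\<in>{0<..<\<tau>}. 0 < fst (z t)) \<and>
       (\<forall>t\<in>{0..\<tau>}. (z has_vector_derivative field (z t)) (at t within {0..\<tau>})))"
    using return_to_section by blast
  have "\<exists>y. solution field y \<and> y 0 = (0, W, p0) \<and> periodic y \<and>
          (\<forall>t. fst (y t) = 0 \<and> 0 < fst (snd (y t)) \<longrightarrow> y t = (0, W, p0))"
    if W: "W0 < W" and p0: "\<bar>p0\<bar> \<le> 1" for W p0
  proof -
    obtain \<tau> z where \<tau>: "0 < \<tau>" and z0: "z 0 = (0, W, p0)" and z\<tau>: "fst (z \<tau>) = 0"
      and above: "\<forall>t\<in>{0<..<\<tau>}. 0 < fst (z t)"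
      and z: "\<forall>t\<in>{0..\<tau>}. (z has_vector_derivative field (z t)) (at t within {0..\<tau>})"
      using return W p0 by blast
    have fixed: "reflection a = a" if "fst a = 0" for a
      using that by (cases a) (simp add: reflection_def)
    obtain y where y: "\<forall>t. (y has_vector_derivative field (y t)) (at t)"
      and per: "\<forall>t. y (t + 2 * \<tau>) = y t" and y0: "y 0 = z 0"
      and on_arc: "\<forall>t. \<exists>s\<in>{0..\<tau>}. y t = z s \<or> y t = reflection (z s)"
      using reflected_arc_periodic_solution[OF \<tau> bounded_linear_reflection field_reflection
          z[rule_format] fixed fixed] z0 z\<tau> by auto
    have down: "fst (snd (z \<tau>)) \<le> 0"
    proof (rule ccontr)
      assume "\<not> ?thesis"
      then have pos: "0 < q (fst (z \<tau>)) * fst (snd (z \<tau>))" using q_pos by simp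
      have "(z has_vector_derivative field (z \<tau>)) (at \<tau> within {0..\<tau>})" using z \<tau> by simp
      from bounded_linear.has_vector_derivative[OF bounded_linear_fst this]
      have "((\<lambda>t. fst (z t)) has_real_derivative q (fst (z \<tau>)) * fst (snd (z \<tau>))) (at \<tau> within {0..\<tau>})"
        by (simp add: has_real_derivative_iff_has_vector_derivative field_def case_prod_unfold)
      from has_real_derivative_pos_inc_left[OF this pos] obtain d where "0 < d"
        and d: "\<And>r. 0 < r \<Longrightarrow> \<tau> - r \<in> {0..\<tau>} \<Longrightarrow> r < d \<Longrightarrow> fst (z (\<tau> - r)) < fst (z \<tau>)"
        by blast
      define r where "r = min d \<tau> / 2"
      have r: "0 < r" "r < d" "r < \<tau>" using \<open>0 < d\<close> \<tau> by (auto simp: r_def)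
      then have "fst (z (\<tau> - r)) < 0" using d[of r] z\<tau> by simp
      moreover have "0 < fst (z (\<tau> - r))" using above r by simp
      ultimately show False by simp
    qed
    have "y t = (0, W, p0)" if "fst (y t) = 0" "0 < fst (snd (y t))" for t
    proof -
      obtain s where s: "s \<in> {0..\<tau>}" "y t = z s \<or> y t = reflection (z s)" using on_arc by blast
      then have "fst (z s) = 0" "0 < fst (snd (z s))"
        using that by (auto simp: reflection_def case_prod_unfold)
      then have "s \<notin> {0<..<\<tau>}" "s \<noteq> \<tau>" using above down by force+
      then have "s = 0" using s by auto
      then show ?thesis using s z0 fixed[of "z 0"] by auto
    qed
    moreover have "solution field y" using y by (simp add: solution_def)
    moreover have "periodic y" using per \<tau> by (auto simp: periodic_def intro!: exI[of _ "2 * \<tau>"])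
    ultimately show ?thesis using y0 z0 by auto
  qed
  then show ?thesis using W0 by blast
qed

end

section \<open>Smoothness of linear maps\<close>

lemma smooth_on_bounded_linear:
  assumes "bounded_linear f"
  shows "smooth_on S f"
proof -
  have const: "Cn_on n S (\<lambda>x. c)" for n and c :: 'b and S :: "'a set"
    by (induction n arbitrary: c) simp_all
  have "frechet_derivative f (at x) = f" for x
    by (rule frechet_derivative_at[OF bounded_linear_imp_has_derivative[OF assms], symmetric])
  moreover have "f differentiable (at x)" for x
    using bounded_linear_imp_has_derivative[OF assms] by (rule differentiableI)
  moreover have "continuous_on S f"
    by (rule linear_continuous_on[OF assms])
  ultimately have "Cn_on n S f" for n
    by (cases n) (simp_all add: const)
  then show ?thesis by (simp add: smooth_on_def)
qed

section \<open>The pendulum in momentum coordinates\<close>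

text \<open>\<open>\<alpha>\<close>, \<open>\<beta>\<close>, \<open>\<gamma>\<close> are the entries of the mass matrix as functions of the relative angle, and \<open>\<Delta>\<close> is its
  determinant. The function \<open>h\<close> is the effect of the follower force on the relative angle, and \<open>g p\<^sup>2\<close> is the derivative of \<open>p\<^sup>2 / (2 \<gamma>)\<close>, the energy that drives the relative angle at a given
  momentum \<open>p\<close>.\<close>

locale ziegler_pendulum =
  fixes m1 m2 m3 l1 l2 l3 F k1 :: real
  assumes pos: "0 < m1" "0 < m2" "0 < m3" "0 < l1" "0 < l2" "0 < l3" "0 < k1"
begin

definition "\<alpha> = A11 m1 m3 l1 l3"
definition "\<mu> = (m1 * l1 - m3 * l3) * l2"
definition "\<beta> x = \<alpha> + \<mu> * cos x"
definition "\<gamma> x = (m1 + m2 + m3) * l2\<^sup>2 + \<alpha> + 2 * \<mu> * cos x"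
definition "\<Delta> x = \<alpha> * \<gamma> x - (\<beta> x)\<^sup>2"
definition "q x = sqrt (\<gamma> x / \<Delta> x)"
definition "h x = F * l2 * sin x * \<beta> x / \<gamma> x"
definition "g x = \<mu> * sin x / (\<gamma> x)\<^sup>2"
definition "f x = F * l2 * sin x"

lemma \<alpha>_pos: "0 < \<alpha>"
  unfolding \<alpha>_def A11_def using pos by (intro add_pos_pos mult_pos_pos) auto

text \<open>The determinant is bounded below uniformly in the angle by the Lagrange identity
  \<open>(m1 l1\<^sup>2 + m3 l3\<^sup>2) (m1 + m3) - (m1 l1 - m3 l3)\<^sup>2 = m1 m3 (l1 + l3)\<^sup>2\<close>; the mass \<open>m2\<close>
  supplies the remaining positive term.\<close>

lemma \<Delta>_ge: "m2 * l2\<^sup>2 * \<alpha> \<le> \<Delta> x"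
proof -
  have "\<Delta> x - m2 * l2\<^sup>2 * \<alpha> = (m1 * m3 * (l1 + l3)\<^sup>2 + (m1 * l1 - m3 * l3)\<^sup>2 * (1 - (cos x)\<^sup>2)) * l2\<^sup>2"
    by (simp add: \<Delta>_def \<beta>_def \<gamma>_def \<mu>_def \<alpha>_def A11_def power2_eq_square algebra_simps)
  also have "\<dots> \<ge> 0"
    using pos by (intro mult_nonneg_nonneg add_nonneg_nonneg) (auto simp: sin_squared_eq[symmetric])
  finally show ?thesis by simp
qed

lemma \<Delta>_pos: "0 < \<Delta> x"
  using \<Delta>_ge[of x] pos \<alpha>_pos by (auto intro: less_le_trans[rotated])

lemma \<gamma>_ge: "m2 * l2\<^sup>2 \<le> \<gamma> x"
proof -
  have "m2 * l2\<^sup>2 * \<alpha> \<le> \<gamma> x * \<alpha>"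
    using \<Delta>_ge[of x] zero_le_power2[of "\<beta> x"] unfolding \<Delta>_def mult.commute[of \<alpha>] by linarith
  then show ?thesis using \<alpha>_pos by (rule mult_right_le_imp_le)
qed

lemma \<gamma>_pos: "0 < \<gamma> x"
  using \<gamma>_ge[of x] pos by (auto intro: less_le_trans[rotated])

lemma q_squared: "q x * q x = \<gamma> x / \<Delta> x"
  using \<gamma>_pos[of x] \<Delta>_pos[of x] by (simp add: q_def)

lemma q_positive: "0 < q x"
  using \<gamma>_pos[of x] \<Delta>_pos[of x] by (simp add: q_def)

lemma deriv_\<beta>: "(\<beta> has_real_derivative - (\<mu> * sin x)) (at x)"
  unfolding \<beta>_def[abs_def] by (auto intro!: derivative_eq_intros)

lemma deriv_\<gamma>: "(\<gamma> has_real_derivative - (2 * (\<mu> * sin x))) (at x)"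
  unfolding \<gamma>_def[abs_def] by (auto intro!: derivative_eq_intros)

text \<open>The factor \<open>\<beta> (\<gamma> - \<beta>)\<close> arises because \<open>\<gamma>' = 2 \<beta>'\<close>, so that
  \<open>\<gamma>' \<Delta> - \<gamma> \<Delta>' = 2 \<beta>' \<beta> (\<gamma> - \<beta>)\<close>.\<close>

lemma deriv_q:
  "(q has_real_derivative - (\<mu> * sin x) * \<beta> x * (\<gamma> x - \<beta> x) / ((\<Delta> x)\<^sup>2 * q x)) (at x)"
proof -
  have "(\<Delta> has_real_derivative - (2 * (\<mu> * sin x)) * (\<alpha> - \<beta> x)) (at x)"
    unfolding \<Delta>_def[abs_def]
    by (rule derivative_eq_intros deriv_\<beta> deriv_\<gamma> refl)+ (simp add: algebra_simps)
  note DERIV_divide[OF deriv_\<gamma> this less_imp_neq[OF \<Delta>_pos, symmetric]]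
  note DERIV_chain2[where f = sqrt and g = "\<lambda>x. \<gamma> x / \<Delta> x",
      OF DERIV_real_sqrt[OF divide_pos_pos[OF \<gamma>_pos \<Delta>_pos]] this]
  then show ?thesis
    unfolding q_def[abs_def] 
  proof (rule DERIV_cong)
    have eq: "- (2 * (\<mu> * sin x)) * \<Delta> x - \<gamma> x * (- (2 * (\<mu> * sin x)) * (\<alpha> - \<beta> x))
        = 2 * (- (\<mu> * sin x) * \<beta> x * (\<gamma> x - \<beta> x))"
      by (simp add: \<Delta>_def algebra_simps power2_eq_square)
    have "inverse r / 2 * (2 * e / (D * D)) = e / (D\<^sup>2 * r)" for r e D :: real
      by (simp add: field_simps power2_eq_square)
    with eq show "inverse (sqrt (\<gamma> x / \<Delta> x)) / 2 *
        ((- (2 * (\<mu> * sin x)) * \<Delta> x - \<gamma> x * (- (2 * (\<mu> * sin x)) * (\<alpha> - \<beta> x))) / (\<Delta> x * \<Delta> x))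
        = - (\<mu> * sin x) * \<beta> x * (\<gamma> x - \<beta> x) / ((\<Delta> x)\<^sup>2 * sqrt (\<gamma> x / \<Delta> x))"
      by (simp only:)
  qed
qed

lemma continuous_coefficients:
  "continuous_on S \<beta>" "continuous_on S \<gamma>" "continuous_on S \<Delta>" "continuous_on S q"
proof -
  show *: "continuous_on S \<beta>" "continuous_on S \<gamma>"
    unfolding \<beta>_def[abs_def] \<gamma>_def[abs_def] by (intro continuous_intros)+
  then show **: "continuous_on S \<Delta>"
    unfolding \<Delta>_def[abs_def] by (intro continuous_intros)
  show "continuous_on S q"
    unfolding q_def[abs_def] using * ** less_imp_neq[OF \<Delta>_pos, symmetric] by (intro continuous_intros) auto
qed

lemma lipschitz_coefficients:
  "lipschitz_on_balls q" "lipschitz_on_balls h" "lipschitz_on_balls g" "lipschitz_on_balls f"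
proof -
  have nz: "\<gamma> x \<noteq> 0" "\<Delta> x \<noteq> 0" "q x \<noteq> 0" for x
    using \<gamma>_pos[of x] \<Delta>_pos[of x] q_positive[of x] by auto
  note cont = continuous_intros continuous_coefficients
  show "lipschitz_on_balls q"
    by (rule lipschitz_on_balls_C1[OF deriv_q]) (intro cont, simp add: nz)
  show "lipschitz_on_balls f"
    by (rule lipschitz_on_balls_C1[where f' = "\<lambda>x. F * l2 * cos x"])
       (auto simp: f_def[abs_def] intro!: derivative_eq_intros continuous_intros)
  have inv: "((\<lambda>x. inverse (\<gamma> x)) has_real_derivative 2 * (\<mu> * sin x) / (\<gamma> x * \<gamma> x)) (at x)" for x
    using DERIV_inverse'[OF deriv_\<gamma> nz(1)] by (simp add: divide_inverse mult.commute mult.left_commute)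
  have lip_inv: "lipschitz_on_balls (\<lambda>x. inverse (\<gamma> x))"
    by (rule lipschitz_on_balls_C1[OF inv]) (intro cont, simp add: nz)
  have lip_\<beta>: "lipschitz_on_balls \<beta>"
    by (rule lipschitz_on_balls_C1[OF deriv_\<beta>]) (intro cont)
  have lip_sin: "lipschitz_on_balls (sin :: real \<Rightarrow> real)"
    by (rule lipschitz_on_balls_C1[OF DERIV_sin]) (intro cont)
  show "lipschitz_on_balls h" "lipschitz_on_balls g"
    unfolding h_def[abs_def] g_def[abs_def] divide_inverse power2_eq_square inverse_mult_distrib
    by (intro lipschitz_on_balls_mult lipschitz_on_balls_const lip_inv lip_\<beta> lip_sin)+
qed

lemma coefficient_bounds:
  defines "\<gamma>0 \<equiv> m2 * l2\<^sup>2" and "\<gamma>1 \<equiv> (m1 + m2 + m3) * l2\<^sup>2 + \<alpha> + 2 * \<bar>\<mu>\<bar>"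
  defines "C \<equiv> max (\<bar>F * l2\<bar> * (\<alpha> + \<bar>\<mu>\<bar>) / \<gamma>0) (max (\<bar>\<mu>\<bar> / \<gamma>0\<^sup>2) \<bar>F * l2\<bar>)"
  shows "sqrt (1 / \<alpha>) \<le> q x" "q x \<le> sqrt (\<gamma>1 / (\<gamma>0 * \<alpha>))"
    "\<bar>h x\<bar> \<le> C" "\<bar>g x\<bar> \<le> C" "\<bar>f x\<bar> \<le> C"
proof -
  have \<gamma>0: "0 < \<gamma>0" "\<gamma>0 \<le> \<gamma> x" using pos \<gamma>_ge by (auto simp: \<gamma>0_def)
  have trig: "\<bar>\<mu> * cos x\<bar> \<le> \<bar>\<mu>\<bar>" "\<bar>\<mu> * sin x\<bar> \<le> \<bar>\<mu>\<bar>" "\<bar>F * l2 * sin x\<bar> \<le> \<bar>F * l2\<bar>"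
    using mult_left_mono[OF abs_cos_le_one[of x] abs_ge_zero[of \<mu>]]
      mult_left_mono[OF abs_sin_le_one[of x] abs_ge_zero[of \<mu>]]
      mult_left_mono[OF abs_sin_le_one[of x] abs_ge_zero[of "F * l2"]] by (simp_all add: abs_mult)
  have \<beta>: "\<bar>\<beta> x\<bar> \<le> \<alpha> + \<bar>\<mu>\<bar>" using trig(1) \<alpha>_pos unfolding \<beta>_def by linarith
  have \<gamma>1: "\<gamma> x \<le> \<gamma>1" using trig(1) unfolding \<gamma>_def \<gamma>1_def by linarith
  have "\<Delta> x \<le> \<alpha> * \<gamma> x" by (simp add: \<Delta>_def)
  then have "1 / \<alpha> \<le> \<gamma> x / \<Delta> x" using \<alpha>_pos \<Delta>_pos[of x] by (simp add: field_simps)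
  then show "sqrt (1 / \<alpha>) \<le> q x" unfolding q_def by (rule real_sqrt_le_mono)
  have "\<gamma> x / \<Delta> x \<le> \<gamma>1 / (\<gamma>0 * \<alpha>)"
    using \<gamma>1 \<gamma>_pos[of x] \<gamma>0 \<alpha>_pos \<Delta>_ge[of x] by (intro frac_le) (auto simp: \<gamma>0_def)
  then show "q x \<le> sqrt (\<gamma>1 / (\<gamma>0 * \<alpha>))" unfolding q_def by (rule real_sqrt_le_mono)
  have "\<bar>h x\<bar> \<le> \<bar>F * l2\<bar> * (\<alpha> + \<bar>\<mu>\<bar>) / \<gamma>0"
    unfolding h_def abs_divide abs_mult[of _ "\<beta> x"] using trig(3) \<beta> \<gamma>0 \<alpha>_pos
    by (intro frac_le mult_mono) auto
  moreover have "\<bar>g x\<bar> \<le> \<bar>\<mu>\<bar> / \<gamma>0\<^sup>2"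
    unfolding g_def abs_divide using trig(2) \<gamma>0 by (intro frac_le power_mono) (auto intro: power_mono)
  ultimately show "\<bar>h x\<bar> \<le> C" "\<bar>g x\<bar> \<le> C" "\<bar>f x\<bar> \<le> C"
    using trig(3) by (simp_all only: C_def f_def le_max_iff_disj simp_thms)
qed

sublocale reduced: reversible_oscillator k1 q h g f "sqrt (1 / \<alpha>)"
  "sqrt (((m1 + m2 + m3) * l2\<^sup>2 + \<alpha> + 2 * \<bar>\<mu>\<bar>) / (m2 * l2\<^sup>2 * \<alpha>))"
  "max (\<bar>F * l2\<bar> * (\<alpha> + \<bar>\<mu>\<bar>) / (m2 * l2\<^sup>2)) (max (\<bar>\<mu>\<bar> / (m2 * l2\<^sup>2)\<^sup>2) \<bar>F * l2\<bar>)"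
proof
  have even: "\<beta> (- x) = \<beta> x" "\<gamma> (- x) = \<gamma> x" "\<Delta> (- x) = \<Delta> x" for x
    by (simp_all add: \<beta>_def \<gamma>_def \<Delta>_def)
  show "q (- x) = q x" "h (- x) = - h x" "g (- x) = - g x" "f (- x) = - f x" for x
    by (simp_all add: q_def h_def g_def f_def even)
  show "0 < sqrt (1 / \<alpha>)" using \<alpha>_pos by simp
qed (rule pos coefficient_bounds lipschitz_coefficients)+

definition to_velocities :: "state \<Rightarrow> state" where
  "to_velocities = (\<lambda>(x, w, p). (x, q x * w, (p - \<beta> x * (q x * w)) / \<gamma> x))"

abbreviation "X \<equiv> ziegler_field m1 m2 m3 l1 l2 l3 F k1"

lemma ziegler_field_eq:
  "X (x, v1, v2) = (v1,
     (\<gamma> x * (- k1 * x - \<mu> * sin x * v2\<^sup>2) - \<beta> x * (- F * l2 * sin x + \<mu> * sin x * v1 * (v1 + 2 * v2))) / \<Delta> x,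
     (\<alpha> * (- F * l2 * sin x + \<mu> * sin x * v1 * (v1 + 2 * v2)) - \<beta> x * (- k1 * x - \<mu> * sin x * v2\<^sup>2)) / \<Delta> x)"
proof -
  have A: "A11 m1 m3 l1 l3 = \<alpha>" "A12 m1 m3 l1 l2 l3 x = \<beta> x" "A22 m1 m2 m3 l1 l2 l3 x = \<gamma> x"
    by (simp_all add: \<alpha>_def \<beta>_def \<gamma>_def \<mu>_def A11_def A12_def A22_def)
  have r: "r1 m1 m3 l1 l2 l3 k1 x v2 = - k1 * x - \<mu> * sin x * v2\<^sup>2"
    "r2 m1 m3 l1 l2 l3 F x v1 v2 = - F * l2 * sin x + \<mu> * sin x * v1 * (v1 + 2 * v2)"
    by (simp_all add: r1_def r2_def \<mu>_def)
  have inv: "inverse (\<alpha> - (\<beta> x)\<^sup>2 / \<gamma> x) = \<gamma> x / \<Delta> x" "inverse (\<gamma> x - (\<beta> x)\<^sup>2 / \<alpha>) = \<alpha> / \<Delta> x"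
  proof -
    have "\<alpha> - (\<beta> x)\<^sup>2 / \<gamma> x = \<Delta> x / \<gamma> x" "\<gamma> x - (\<beta> x)\<^sup>2 / \<alpha> = \<Delta> x / \<alpha>"
      using \<gamma>_pos[of x] \<alpha>_pos by (simp_all add: \<Delta>_def field_simps)
    then show "inverse (\<alpha> - (\<beta> x)\<^sup>2 / \<gamma> x) = \<gamma> x / \<Delta> x" "inverse (\<gamma> x - (\<beta> x)\<^sup>2 / \<alpha>) = \<alpha> / \<Delta> x"
      by simp_all
  qed
  have "(a - b / c * d) * (c / e) = (c * a - b * d) / e" if "0 < c" for a b c d e :: real
  proof -
    have "a - b / c * d = (c * a - b * d) / c" using that by (simp add: field_simps)
    then show ?thesis using that by simp
  qed
  from this[OF \<gamma>_pos] this[OF \<alpha>_pos] show ?thesis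
    by (simp only: ziegler_field_def Let_def prod.case A r inv)
qed

text \<open>The change of coordinates conjugates the oscillator to the pendulum. By the chain rule the
  new velocities satisfy \<open>v1' = q' \<phi>' w + q w'\<close> and \<open>\<gamma> v2' = r2 - \<beta> v1'\<close>; the first becomes the
  first row of the inverse mass matrix after \<open>w\<close> and \<open>q\<close> are eliminated through \<open>w = v1 / q\<close> and
  \<open>q\<^sup>2 = \<gamma> / \<Delta>\<close>, and the second then yields the other row.\<close>

lemma to_velocities_solution:
  assumes "solution reduced.field y"
  shows "solution X (\<lambda>t. to_velocities (y t))"
  unfolding solution_def
proof
  fix t
  let ?\<phi> = "\<lambda>t. fst (y t)" and ?w = "\<lambda>t. fst (snd (y t))" and ?p = "\<lambda>t. snd (snd (y t))"
  define x where "x = ?\<phi> t"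
  define v1 where "v1 = q x * ?w t"
  define v2 where "v2 = (?p t - \<beta> x * v1) / \<gamma> x"
  define S where "S = \<mu> * sin x"
  have "(y has_vector_derivative reduced.field (y t)) (at t)"
    using assms by (simp add: solution_def)
  then have y: "(y has_vector_derivative (v1, q x * (h x - k1 * x - g x * (?p t)\<^sup>2), - f x)) (at t)"
    by (simp add: reduced.field_def case_prod_unfold x_def v1_def)
  have lin: "bounded_linear (\<lambda>a :: state. fst a)" "bounded_linear (\<lambda>a :: state. fst (snd a))"
    "bounded_linear (\<lambda>a :: state. snd (snd a))"
    by (intro bounded_linear_intros)+
  note d = lin[THEN bounded_linear.has_vector_derivative, OF y]
  have \<phi>': "(?\<phi> has_real_derivative v1) (at t)"
    and w': "(?w has_real_derivative q x * (h x - k1 * x - g x * (?p t)\<^sup>2)) (at t)"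
    and p': "(?p has_real_derivative - f x) (at t)"
    using d by (simp_all add: has_real_derivative_iff_has_vector_derivative)
  have along: "((\<lambda>t. u (?\<phi> t)) has_real_derivative u' * v1) (at t)"
    if "(u has_real_derivative u') (at x)" for u u'
    by (rule DERIV_chain2[where f = u and g = ?\<phi>, OF that[unfolded x_def] \<phi>'])
  define V1 where "V1 = (\<gamma> x * (- k1 * x - S * v2\<^sup>2) - \<beta> x * (- F * l2 * sin x + S * v1 * (v1 + 2 * v2))) / \<Delta> x"
  define V2 where "V2 = (\<alpha> * (- F * l2 * sin x + S * v1 * (v1 + 2 * v2)) - \<beta> x * (- k1 * x - S * v2\<^sup>2)) / \<Delta> x"
  note nz = \<gamma>_pos[of x, THEN less_imp_neq, symmetric] \<Delta>_pos[of x, THEN less_imp_neq, symmetric]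
    q_positive[of x, THEN less_imp_neq, symmetric]
  have p_eq: "?p t = \<beta> x * v1 + \<gamma> x * v2" using nz by (simp add: v2_def)
  have v1': "((\<lambda>t. q (?\<phi> t) * ?w t) has_real_derivative V1) (at t)"
  proof (rule DERIV_cong[OF DERIV_mult[OF along[OF deriv_q] w']])
    have "v1 * ?w t / q x = v1\<^sup>2 / (q x * q x)"
      using nz by (simp add: v1_def power2_eq_square)
    also have "\<dots> = v1\<^sup>2 * \<Delta> x / \<gamma> x" by (simp add: q_squared)
    finally have vw: "v1 * ?w t / q x = v1\<^sup>2 * \<Delta> x / \<gamma> x" .
    have "- (\<mu> * sin x) * \<beta> x * (\<gamma> x - \<beta> x) / ((\<Delta> x)\<^sup>2 * q x) * v1 * ?w t +
        q x * (h x - k1 * x - g x * (?p t)\<^sup>2) * q (?\<phi> t)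
        = - S * \<beta> x * (\<gamma> x - \<beta> x) / (\<Delta> x)\<^sup>2 * (v1 * ?w t / q x) +
          (q x * q x) * (h x - k1 * x - g x * (?p t)\<^sup>2)"
      by (simp add: x_def S_def)
    also have "\<dots> = - S * \<beta> x * (\<gamma> x - \<beta> x) / (\<Delta> x)\<^sup>2 * (v1\<^sup>2 * \<Delta> x / \<gamma> x) +
          \<gamma> x / \<Delta> x * (F * l2 * sin x * \<beta> x / \<gamma> x - k1 * x - S / (\<gamma> x)\<^sup>2 * (\<beta> x * v1 + \<gamma> x * v2)\<^sup>2)"
      unfolding vw q_squared h_def g_def S_def p_eq ..
    also have "\<dots> = V1"
      unfolding V1_def using nz by (simp add: field_simps power2_eq_square)
    finally show "- (\<mu> * sin x) * \<beta> x * (\<gamma> x - \<beta> x) / ((\<Delta> x)\<^sup>2 * q x) * v1 * ?w t +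
        q x * (h x - k1 * x - g x * (?p t)\<^sup>2) * q (?\<phi> t) = V1" .
  qed
  have v2': "((\<lambda>t. (?p t - \<beta> (?\<phi> t) * (q (?\<phi> t) * ?w t)) / \<gamma> (?\<phi> t)) has_real_derivative V2) (at t)"
  proof (rule DERIV_cong[OF DERIV_divide[OF DERIV_diff[OF p' DERIV_mult[OF along[OF deriv_\<beta>] v1']] along[OF deriv_\<gamma>]]])
    show "\<gamma> (?\<phi> t) \<noteq> 0" using nz by (simp add: x_def)
    have elim: "((- c - (- S * v1 * v1 + V1 * b)) * e - (e * v2) * (- (2 * S) * v1)) / (e * e)
        = (- c + S * v1 * (v1 + 2 * v2) - b * V1) / e" if "e \<noteq> 0" for b c e
      using that by (simp add: field_simps)
    have solve: "(R2 - b * ((e * R1 - b * R2) / D)) / e = (a * R2 - b * R1) / D"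
      if "D = a * e - b\<^sup>2" "e \<noteq> 0" "D \<noteq> 0" for a b e R1 R2 D :: real
      using that(2,3) by (simp add: field_simps) (simp add: that(1) algebra_simps power2_eq_square)
    have "?p t - \<beta> (?\<phi> t) * (q (?\<phi> t) * ?w t) = \<gamma> x * v2"
      unfolding x_def[symmetric] v1_def[symmetric] p_eq by simp
    then show "((- f x - (- (\<mu> * sin x) * v1 * (q (?\<phi> t) * ?w t) + V1 * \<beta> (?\<phi> t))) * \<gamma> (?\<phi> t) -
        (?p t - \<beta> (?\<phi> t) * (q (?\<phi> t) * ?w t)) * (- (2 * (\<mu> * sin x)) * v1)) / (\<gamma> (?\<phi> t) * \<gamma> (?\<phi> t)) = V2"
      unfolding x_def[symmetric] v1_def[symmetric] S_def[symmetric]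
      using elim[OF nz(1), of "f x" "\<beta> x"] solve[OF \<Delta>_def nz(1,2)]
      by (simp only: V1_def V2_def f_def mult_minus_left)
  qed
  have "((\<lambda>t. to_velocities (y t)) has_vector_derivative (v1, V1, V2)) (at t)"
    unfolding to_velocities_def case_prod_unfold
    using \<phi>' v1' v2'
    by (intro has_vector_derivative_Pair) (simp_all add: has_real_derivative_iff_has_vector_derivative)
  moreover have "X (to_velocities (y t)) = (v1, V1, V2)"
    unfolding to_velocities_def case_prod_unfold x_def[symmetric] v1_def[symmetric] v2_def[symmetric]
      ziegler_field_eq V1_def V2_def S_def ..
  ultimately show "((\<lambda>t. to_velocities (y t)) has_vector_derivative X (to_velocities (y t))) (at t)" by simp
qed

lemma inj_to_velocities: "inj to_velocities"
proof (rule injI)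
  fix a b :: state assume "to_velocities a = to_velocities b"
  then show "a = b"
    using q_positive[of "fst b"] \<gamma>_pos[of "fst b"]
    by (auto simp: to_velocities_def case_prod_unfold prod_eq_iff)
qed

section \<open>The two-parameter family\<close>

text \<open>The restriction of \<open>to_velocities\<close> to the plane \<open>\<phi> = 0\<close> is linear, since the coefficients are
  frozen there. It is the parametrisation \<open>\<sigma>\<close>, and its derivative is \<open>\<sigma>\<close> itself.\<close>

theorem two_parameter_family: "two_parameter_family_of_periodic_solutions X"
proof -
  obtain W0 where W0: "0 < W0" and orbits: "\<forall>W p0. W0 < W \<and> \<bar>p0\<bar> \<le> 1 \<longrightarrow>
     (\<exists>y. solution reduced.field y \<and> y 0 = (0, W, p0) \<and> periodic y \<and>
          (\<forall>t. fst (y t) = 0 \<and> 0 < fst (snd (y t)) \<longrightarrow> y t = (0, W, p0)))"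
    using reduced.periodic_orbits by blast
  define U :: "(real \<times> real) set" where "U = {W0<..} \<times> {-1<..<1}"
  define \<sigma> where "\<sigma> u = to_velocities (0, u)" for u
  have U: "W0 < fst u" "\<bar>snd u\<bar> \<le> 1" if "u \<in> U" for u
    using that by (auto simp: U_def)
  have "\<forall>u\<in>U. \<exists>y. solution reduced.field y \<and> y 0 = (0, u) \<and> periodic y \<and>
          (\<forall>t. fst (y t) = 0 \<and> 0 < fst (snd (y t)) \<longrightarrow> y t = (0, u))"
    using orbits by (auto simp: U_def)
  then obtain y where y: "\<And>u. u \<in> U \<Longrightarrow> solution reduced.field (y u)" "\<And>u. u \<in> U \<Longrightarrow> y u 0 = (0, u)"
      "\<And>u. u \<in> U \<Longrightarrow> periodic (y u)"
      "\<And>u t. u \<in> U \<Longrightarrow> fst (y u t) = 0 \<Longrightarrow> 0 < fst (snd (y u t)) \<Longrightarrow> y u t = (0, u)"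
    by metis
  have \<sigma>_eq: "\<sigma> u = (0, q 0 * fst u, (snd u - \<beta> 0 * (q 0 * fst u)) / \<gamma> 0)" for u
    by (simp add: \<sigma>_def to_velocities_def case_prod_unfold)
  have lin: "bounded_linear \<sigma>"
    unfolding \<sigma>_eq[abs_def] divide_inverse
    by (intro bounded_linear_Pair bounded_linear_zero bounded_linear_mult_const
        bounded_linear_const_mult bounded_linear_sub bounded_linear_fst bounded_linear_snd)
  have d\<sigma>: "frechet_derivative \<sigma> (at u) = \<sigma>" for u
    by (rule frechet_derivative_at[OF bounded_linear_imp_has_derivative[OF lin], symmetric])
  have inj: "inj \<sigma>"
    by (rule injI) (metis \<sigma>_def inj_to_velocities injD prod.inject)
  let ?x = "\<lambda>u t. to_velocities (y u t)"
  have sol: "solution X (?x u)" if "u \<in> U" for u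
    by (rule to_velocities_solution[OF y(1)[OF that]])
  have start: "?x u 0 = \<sigma> u" if "u \<in> U" for u
    by (simp add: y(2)[OF that] \<sigma>_def)
  have moving: "0 < fst (X (\<sigma> u))" if "u \<in> U" for u
    unfolding \<sigma>_eq ziegler_field_eq using W0 U(1)[OF that] q_positive[of 0] by simp
  have transverse: "X (\<sigma> u) \<notin> range \<sigma>" if "u \<in> U" for u
    using moving[OF that] by (auto simp: \<sigma>_eq)
  have nonconstant: "\<not> ?x u constant_on UNIV" if u: "u \<in> U" for u
  proof
    assume "?x u constant_on UNIV"
    then obtain c where "\<And>t. ?x u t = c" by (auto simp: constant_on_def)
    then have "?x u = (\<lambda>t. c)" by blast
    then have "((\<lambda>t. c) has_vector_derivative X (\<sigma> u)) (at 0)"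
      using sol[OF u] start[OF u] unfolding solution_def by metis
    then have "X (\<sigma> u) = 0"
      using has_vector_derivative_const vector_derivative_unique_at by blast
    then show False using moving[OF u] by simp
  qed
  have distinct: "range (?x u) \<noteq> range (?x u')" if u: "u \<in> U" "u' \<in> U" "u \<noteq> u'" for u u'
  proof
    assume "range (?x u) = range (?x u')"
    then have "\<sigma> u' \<in> range (?x u)" using start[OF u(2)] by (metis rangeI)
    then obtain t where "to_velocities (0, u') = to_velocities (y u t)" by (auto simp: \<sigma>_def)
    then have t: "y u t = (0, u')" using inj_to_velocities by (metis injD)
    then have "y u t = (0, u)"
      using W0 U(1)[OF u(2)] by (intro y(4)[OF u(1)]) auto
    then show False using t u(3) by simp
  qed
  have "open U" unfolding U_def by (intro open_Times) auto
  moreover have "(W0 + 1, 0) \<in> U" by (simp add: U_def)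
  moreover have "periodic (?x u)" if "u \<in> U" for u
    using y(3)[OF that] unfolding periodic_def by metis
  ultimately show ?thesis
    unfolding two_parameter_family_of_periodic_solutions_def
    using smooth_on_bounded_linear[OF lin] inj sol start nonconstant distinct transverse
    by (intro exI[of _ U] exI[of _ \<sigma>] exI[of _ ?x]) (auto simp: d\<sigma> intro: inj_on_subset)
qed

end

theorem proposition10:
  fixes k1 :: real
  assumes "k1 > 0"
  shows "\<exists>\<epsilon>>0. \<forall>m1 m2 m3 l1 l2 l3 F :: real.
           m1 > 0 \<and> m2 > 0 \<and> m3 > 0 \<and> l1 > 0 \<and> l2 > 0 \<and> l3 > 0 \<and>
           \<bar>m1 * l1 - m3 * l3\<bar> < \<epsilon> \<longrightarrow>
           two_parameter_family_of_periodic_solutions (ziegler_field m1 m2 m3 l1 l2 l3 F k1)"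
proof (intro exI[of _ 1] conjI allI impI)
  fix m1 m2 m3 l1 l2 l3 F :: real
  assume "m1 > 0 \<and> m2 > 0 \<and> m3 > 0 \<and> l1 > 0 \<and> l2 > 0 \<and> l3 > 0 \<and> \<bar>m1 * l1 - m3 * l3\<bar> < 1"
  then interpret ziegler_pendulum m1 m2 m3 l1 l2 l3 F k1
    using assms by unfold_locales auto
  show "two_parameter_family_of_periodic_solutions (ziegler_field m1 m2 m3 l1 l2 l3 F k1)"
    by (rule two_parameter_family)
qed simp

end
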